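(* Assume (A2) and (A3), and consider parameter values $(\eta,\sigma^2,b,d)$ for which $\rho<0$, so that the tail-index $\alpha$ (the unique $\alpha>0$ with $h(\alpha)=1$) is defined. Then: the tail-index $\alpha$ is strictly increasing in the batch-size $b$ and strictly decreasing in the stepsize $\eta$ and in the variance $\sigma^2$, provided that $\alpha\ge 1$; moreover, $\alpha$ is strictly decreasing in the dimension $d$.
   Context: Setup: integers $d,b\ge1$, stepsize $\eta>0$, i.i.d. data $(a_i,y_i)$ with $a_i\in\mathbb{R}^d$, $y_i\in\mathbb{R}$; $H_k=\sum_{i=b(k-1)+1}^{bk}a_ia_i^T$, $M_k=I_d-\frac{\eta}{b}H_k$, $q_k=\frac{\eta}{b}\sum_{i=b(k-1)+1}^{bk}a_iy_i$, SGD iterates $x_k=M_kx_{k-1}+q_k$. $\|\cdot\|$ is the Euclidean/spectral norm. $\Pi_k=M_k\cdots M_1$, $h(s)=\lim_{k\to\infty}(\mathbb{E}\|\Pi_k\|^s)^{1/k}$, $\rho=\lim_{k\to\infty}(2k)^{-1}\log\lambda_{\max}(\Pi_k^T\Pi_k)$. Assumptions: (A2) $y_i$ i.i.d. with continuous density supported on $\mathbb{R}$, all moments finite. (A3) $a_i\sim\mathcal{N}(0,\sigma^2I_d)$ i.i.d. Under these assumptions and $\rho<0$ there is a unique $\alpha>0$ with $h(\alpha)=1$, called the tail-index. *)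

theory Defs
  imports "HOL-Probability.Probability" "Jordan_Normal_Form.Char_Poly"
begin

text \<open>Parameters: stepsize eta, variance v (= sigma^2), batch size b, dimension d.
  All data are realised on one canonical probability space: a sample
  omega :: nat \<times> nat \<Rightarrow> real, where omega (i, j) is the j-th coordinate
  (j < d) of the data vector a_i (i \<ge> 1). All coordinates are i.i.d.
  N(0, v), i.e. a_i ~ N(0, v I_d) i.i.d.  The responses y_i do not enter
  h, rho or the tail-index, so they are not modelled.\<close>

definition data_space :: "real \<Rightarrow> (nat \<times> nat \<Rightarrow> real) measure" where
  "data_space v = PiM UNIV (\<lambda>_. density lborel (normal_density 0 (sqrt v)))"

definition avec :: "nat \<Rightarrow> (nat \<times> nat \<Rightarrow> real) \<Rightarrow> nat \<Rightarrow> real vec" where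
  "avec d \<omega> i = vec d (\<lambda>j. \<omega> (i, j))"

definition Hmat :: "nat \<Rightarrow> nat \<Rightarrow> (nat \<times> nat \<Rightarrow> real) \<Rightarrow> nat \<Rightarrow> real mat" where
  "Hmat b d \<omega> k = mat d d (\<lambda>(p, q). \<Sum>i\<in>{b * (k - 1) + 1 .. b * k}.
      (avec d \<omega> i) $ p * (avec d \<omega> i) $ q)"

definition Mmat :: "real \<Rightarrow> nat \<Rightarrow> nat \<Rightarrow> (nat \<times> nat \<Rightarrow> real) \<Rightarrow> nat \<Rightarrow> real mat" where
  "Mmat \<eta> b d \<omega> k = 1\<^sub>m d - (\<eta> / real b) \<cdot>\<^sub>m Hmat b d \<omega> k"

fun Pimat :: "real \<Rightarrow> nat \<Rightarrow> nat \<Rightarrow> (nat \<times> nat \<Rightarrow> real) \<Rightarrow> nat \<Rightarrow> real mat" where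
  "Pimat \<eta> b d \<omega> 0 = 1\<^sub>m d"
| "Pimat \<eta> b d \<omega> (Suc k) = Mmat \<eta> b d \<omega> (Suc k) * Pimat \<eta> b d \<omega> k"

definition vnorm :: "real vec \<Rightarrow> real" where
  "vnorm x = sqrt (scalar_prod x x)"

definition spec_norm :: "nat \<Rightarrow> real mat \<Rightarrow> real" where
  "spec_norm d A = Sup {vnorm (A *\<^sub>v x) | x. x \<in> carrier_vec d \<and> vnorm x = 1}"

definition lambda_max :: "real mat \<Rightarrow> real" where
  "lambda_max A = Max {l. eigenvalue A l}"

definition hfun :: "real \<Rightarrow> real \<Rightarrow> nat \<Rightarrow> nat \<Rightarrow> real \<Rightarrow> real" where
  "hfun \<eta> v b d s = lim (\<lambda>k. (\<integral>\<omega>. spec_norm d (Pimat \<eta> b d \<omega> k) powr s \<partial>data_space v)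
      powr (1 / real k))"

definition rho :: "real \<Rightarrow> real \<Rightarrow> nat \<Rightarrow> nat \<Rightarrow> real" where
  "rho \<eta> v b d = (THE r. AE \<omega> in data_space v.
      (\<lambda>k. ln (lambda_max (transpose_mat (Pimat \<eta> b d \<omega> k) * Pimat \<eta> b d \<omega> k))
         / (2 * real k)) \<longlonglongrightarrow> r)"

definition admissible :: "real \<Rightarrow> real \<Rightarrow> nat \<Rightarrow> nat \<Rightarrow> bool" where
  "admissible \<eta> v b d \<longleftrightarrow> \<eta> > 0 \<and> v > 0 \<and> b \<ge> 1 \<and> d \<ge> 1 \<and> rho \<eta> v b d < 0"

definition tail_index :: "real \<Rightarrow> real \<Rightarrow> nat \<Rightarrow> nat \<Rightarrow> real" where
  "tail_index \<eta> v b d = (THE \<alpha>. \<alpha> > 0 \<and> hfun \<eta> v b d \<alpha> = 1)"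

end

theory Submission
  imports Defs
begin

text \<open>Only the product \<open>\<eta> \<sigma>\<^sup>2\<close> matters, so let \<open>\<sigma> = 1\<close>. By rotation invariance of the Gaussian law and
  independence of the batches, \<open>E |\<Pi>\<^sub>k u|\<^sup>s = g(s)\<^sup>k\<close> for every unit vector \<open>u\<close>, where
  \<open>g(s) = E |M\<^sub>1 e\<^sub>1|\<^sup>s\<close>. The spectral norm of \<open>\<Pi>\<^sub>k\<close> lies between the norm of any of its columns and the sum
  of all of these norms, hence \<open>h = g\<close>, and a Chernoff bound with small positive and negative \<open>s\<close>
  together with the Borel-Cantelli lemma gives \<open>\<rho> = E ln |M\<^sub>1 e\<^sub>1|\<close>. The function \<open>g\<close> is strictly convex with
  \<open>g(0) = 1\<close> and slope \<open>\<rho>\<close> at 0, so for \<open>\<rho> < 0\<close> the tail-index is the point where \<open>g\<close> crosses 1 from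
  below, and it suffices to compare the functions \<open>g\<close> for different parameters. Enlarging \<open>d\<close> adds
  squares to \<open>|M\<^sub>1 e\<^sub>1|\<^sup>2\<close>. For \<open>s \<ge> 1\<close>, \<open>g\<close> is strictly convex in \<open>\<eta> \<sigma>\<^sup>2\<close> with value 1 at 0, and
  averaging leave-one-out batches (Jensen's inequality) shows that \<open>g\<close> strictly decreases in \<open>b\<close>.
  Since the Gaussian product measure charges every nonempty open set and all integrands are continuous,
  each strict inequality need only be checked at a single sample point.\<close>

section \<open>Product measures\<close>

lemma nn_integral_PiM_fun_upd:
  fixes M :: "'i \<Rightarrow> 'a measure"
  assumes prob_M: "\<And>i. prob_space (M i)"
    and f_measurable [measurable]: "f \<in> borel_measurable (PiM UNIV M)"
  shows "(\<integral>\<^sup>+w. f w \<partial>PiM UNIV M) = (\<integral>\<^sup>+w. \<integral>\<^sup>+x. f (w(i := x)) \<partial>M i \<partial>PiM UNIV M)"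
proof -
  interpret Mi: prob_space "M i" by (rule prob_M)
  interpret P: prob_space "PiM UNIV M" by (intro prob_space_PiM prob_M)
  interpret pair_sigma_finite "M i" "PiM UNIV M" ..
  have measurable_upd [measurable]: "(\<lambda>(x, w). w(i := x)) \<in> M i \<Otimes>\<^sub>M PiM UNIV M \<rightarrow>\<^sub>M PiM UNIV M"
    by (simp add: case_prod_beta') (rule measurable_fun_upd[where J=UNIV], auto)
  have "(\<integral>\<^sup>+w. f w \<partial>PiM UNIV M)
      = (\<integral>\<^sup>+w. f w \<partial>distr (M i \<Otimes>\<^sub>M PiM UNIV M) (PiM UNIV M) (\<lambda>(x, w). w(i := x)))"
    using distr_pair_PiM_eq_PiM[of UNIV M i] prob_M by simp
  also have "\<dots> = (\<integral>\<^sup>+(x, w). f (w(i := x)) \<partial>(M i \<Otimes>\<^sub>M PiM UNIV M))"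
    by (simp add: nn_integral_distr case_prod_beta')
  also have "\<dots> = (\<integral>\<^sup>+w. \<integral>\<^sup>+x. f (w(i := x)) \<partial>M i \<partial>PiM UNIV M)"
    by (subst nn_integral_snd[symmetric]) (simp_all add: case_prod_beta')
  finally show ?thesis .
qed

lemma AE_PiM_fun_upd:
  fixes M :: "'i \<Rightarrow> 'a measure"
  assumes prob_M: "\<And>i. prob_space (M i)"
    and Q_measurable [measurable]: "Measurable.pred (PiM UNIV M) Q"
    and AE_fiber: "\<And>w. AE x in M i. Q (w(i := x))"
  shows "AE w in PiM UNIV M. Q w"
proof -
  let ?f = "\<lambda>w. if Q w then 0 else 1 :: ennreal"
  have "(\<integral>\<^sup>+w. ?f w \<partial>PiM UNIV M) = (\<integral>\<^sup>+w. \<integral>\<^sup>+x. ?f (w(i := x)) \<partial>M i \<partial>PiM UNIV M)"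
    by (rule nn_integral_PiM_fun_upd[OF prob_M]) measurable
  also have "(\<integral>\<^sup>+x. ?f (w(i := x)) \<partial>M i) = 0" for w
    using AE_fiber[of w] by (subst nn_integral_cong_AE[where v="\<lambda>_. 0"]) auto
  then have "(\<integral>\<^sup>+w. \<integral>\<^sup>+x. ?f (w(i := x)) \<partial>M i \<partial>PiM UNIV M) = 0"
    by simp
  finally have "AE w in PiM UNIV M. ?f w = 0"
    by (subst (asm) nn_integral_0_iff_AE) auto
  then show ?thesis
    by eventually_elim (auto split: if_splits)
qed

lemma measurable_override_on [measurable]:
  "(\<lambda>(w, w'). override_on w w' J) \<in> PiM UNIV M \<Otimes>\<^sub>M PiM UNIV M \<rightarrow>\<^sub>M PiM UNIV M"
  by (rule measurable_PiM_single')
     (auto simp: override_on_def case_prod_beta' space_pair_measure space_PiM PiE_iff)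

lemma distr_PiM_override_on:
  fixes M :: "'i \<Rightarrow> 'a measure"
  assumes prob_M: "\<And>i. prob_space (M i)"
  shows "distr (PiM UNIV M \<Otimes>\<^sub>M PiM UNIV M) (PiM UNIV M) (\<lambda>(w, w'). override_on w w' J) = PiM UNIV M"
proof (rule measure_eqI_PiM_infinite[symmetric, OF refl])
  interpret P: prob_space "PiM UNIV M" by (intro prob_space_PiM prob_M)
  show "finite_measure (PiM UNIV M)" by unfold_locales
  fix A K
  assume finite_K: "finite K" and A_sets: "\<And>i. i \<in> K \<Longrightarrow> A i \<in> sets (M i)"
  let ?box = "\<lambda>K. prod_emb UNIV M K (Pi\<^sub>E K A)"
  have "(\<lambda>(w, w'). override_on w w' J) -` ?box K \<inter> space (PiM UNIV M \<Otimes>\<^sub>M PiM UNIV M)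
      = ?box (K - J) \<times> ?box (K \<inter> J)"
    by (fastforce simp: prod_emb_def space_pair_measure space_PiM PiE_iff override_on_def)
  then have "emeasure (distr (PiM UNIV M \<Otimes>\<^sub>M PiM UNIV M) (PiM UNIV M) (\<lambda>(w, w'). override_on w w' J)) (?box K)
      = emeasure (PiM UNIV M) (?box (K - J)) * emeasure (PiM UNIV M) (?box (K \<inter> J))"
    using finite_K A_sets by (simp add: emeasure_distr sets_PiM_I P.emeasure_pair_measure_Times)
  also have "\<dots> = (\<Prod>i\<in>K - J. emeasure (M i) (A i)) * (\<Prod>i\<in>K \<inter> J. emeasure (M i) (A i))"
    using finite_K A_sets by (intro arg_cong2[where f="(*)"] emeasure_PiM_emb prob_M) auto
  also have "\<dots> = (\<Prod>i\<in>K. emeasure (M i) (A i))"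
    using prod.Int_Diff[OF finite_K, of "\<lambda>i. emeasure (M i) (A i)" J] by (simp add: mult.commute)
  also have "\<dots> = emeasure (PiM UNIV M) (?box K)"
    using finite_K A_sets prob_M by (simp add: emeasure_PiM_emb)
  finally show "emeasure (PiM UNIV M) (?box K)
      = emeasure (distr (PiM UNIV M \<Otimes>\<^sub>M PiM UNIV M) (PiM UNIV M) (\<lambda>(w, w'). override_on w w' J)) (?box K)" ..
qed simp

lemma nn_integral_PiM_override_on:
  fixes M :: "'i \<Rightarrow> 'a measure"
  assumes prob_M: "\<And>i. prob_space (M i)"
    and f_measurable [measurable]: "f \<in> borel_measurable (PiM UNIV M)"
  shows "(\<integral>\<^sup>+w. f w \<partial>PiM UNIV M) = (\<integral>\<^sup>+w. \<integral>\<^sup>+w'. f (override_on w w' J) \<partial>PiM UNIV M \<partial>PiM UNIV M)"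
proof -
  interpret P: prob_space "PiM UNIV M" by (intro prob_space_PiM prob_M)
  have "(\<integral>\<^sup>+w. f w \<partial>PiM UNIV M)
      = (\<integral>\<^sup>+w. f w \<partial>distr (PiM UNIV M \<Otimes>\<^sub>M PiM UNIV M) (PiM UNIV M) (\<lambda>(w, w'). override_on w w' J))"
    by (simp add: distr_PiM_override_on prob_M)
  also have "\<dots> = (\<integral>\<^sup>+(w, w'). f (override_on w w' J) \<partial>(PiM UNIV M \<Otimes>\<^sub>M PiM UNIV M))"
    by (simp add: nn_integral_distr case_prod_beta')
  also have "\<dots> = (\<integral>\<^sup>+w. \<integral>\<^sup>+w'. f (override_on w w' J) \<partial>PiM UNIV M \<partial>PiM UNIV M)"
    by (subst P.nn_integral_fst[symmetric]) (simp_all add: case_prod_beta')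
  finally show ?thesis .
qed

lemma nn_integral_PiM_reindex:
  fixes N :: "'a measure" and \<pi> :: "'i \<Rightarrow> 'j"
  assumes prob_N: "prob_space N" and "inj \<pi>"
    and f_measurable [measurable]: "f \<in> borel_measurable (PiM UNIV (\<lambda>_. N))"
  shows "(\<integral>\<^sup>+w. f (\<lambda>i. w (\<pi> i)) \<partial>PiM UNIV (\<lambda>_. N)) = (\<integral>\<^sup>+w. f w \<partial>PiM UNIV (\<lambda>_. N))"
proof -
  have [measurable]: "(\<lambda>w i. w (\<pi> i)) \<in> PiM UNIV (\<lambda>_. N) \<rightarrow>\<^sub>M PiM UNIV (\<lambda>_. N)"
    by (rule measurable_PiM_single') (auto simp: space_PiM PiE_iff)
  have "distr (PiM UNIV (\<lambda>_. N)) (PiM UNIV (\<lambda>_. N)) (\<lambda>w i. w (\<pi> i)) = PiM UNIV (\<lambda>_. N)"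
    using distr_PiM_reindex[of UNIV "\<lambda>_. N" \<pi> UNIV] assms by (simp add: restrict_def)
  then have "(\<integral>\<^sup>+w. f w \<partial>PiM UNIV (\<lambda>_. N))
      = (\<integral>\<^sup>+w. f w \<partial>distr (PiM UNIV (\<lambda>_. N)) (PiM UNIV (\<lambda>_. N)) (\<lambda>w i. w (\<pi> i)))"
    by simp
  also have "\<dots> = (\<integral>\<^sup>+w. f (\<lambda>i. w (\<pi> i)) \<partial>PiM UNIV (\<lambda>_. N))"
    by (simp add: nn_integral_distr)
  finally show ?thesis ..
qed

lemma distr_PiM_map:
  fixes M :: "'i \<Rightarrow> 'a measure" and N :: "'i \<Rightarrow> 'b measure"
  assumes prob_M: "\<And>i. prob_space (M i)" and f_measurable [measurable]: "\<And>i. f i \<in> M i \<rightarrow>\<^sub>M N i"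
  shows "distr (PiM UNIV M) (PiM UNIV N) (\<lambda>w i. f i (w i)) = PiM UNIV (\<lambda>i. distr (M i) (N i) (f i))"
proof (rule measure_eqI_PiM_infinite[symmetric, OF refl])
  let ?D = "\<lambda>i. distr (M i) (N i) (f i)"
  have prob_D: "prob_space (?D i)" for i
    by (rule prob_space.prob_space_distr[OF prob_M f_measurable])
  interpret D: prob_space "PiM UNIV ?D" by (intro prob_space_PiM prob_D)
  show "finite_measure (PiM UNIV ?D)" by unfold_locales
  have measurable_map [measurable]: "(\<lambda>w i. f i (w i)) \<in> PiM UNIV M \<rightarrow>\<^sub>M PiM UNIV N"
    by (rule measurable_PiM_single')
       (auto simp: space_PiM PiE_iff intro: measurable_space[OF f_measurable])
  show "sets (distr (PiM UNIV M) (PiM UNIV N) (\<lambda>w i. f i (w i))) = sets (PiM UNIV ?D)"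
    by (simp cong: sets_PiM_cong)
  fix A J
  assume finite_J: "finite J" and A_sets: "\<And>i. i \<in> J \<Longrightarrow> A i \<in> sets (?D i)"
  let ?box = "prod_emb UNIV ?D J (Pi\<^sub>E J A)"
  have box_sets: "?box \<in> sets (PiM UNIV N)"
    using finite_J A_sets sets_PiM_I[of J UNIV A N] by (simp add: prod_emb_def)
  have "(\<lambda>w i. f i (w i)) -` ?box \<inter> space (PiM UNIV M)
      = prod_emb UNIV M J (\<Pi>\<^sub>E i\<in>J. f i -` A i \<inter> space (M i))"
    by (auto simp: prod_emb_def space_PiM PiE_iff intro: measurable_space[OF f_measurable])
  then have "emeasure (distr (PiM UNIV M) (PiM UNIV N) (\<lambda>w i. f i (w i))) ?box
      = (\<Prod>i\<in>J. emeasure (M i) (f i -` A i \<inter> space (M i)))"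
    using finite_J A_sets box_sets prob_M
    by (simp add: emeasure_distr emeasure_PiM_emb measurable_sets[OF f_measurable])
  also have "\<dots> = (\<Prod>i\<in>J. emeasure (?D i) (A i))"
    using A_sets by (intro prod.cong) (simp_all add: emeasure_distr)
  also have "\<dots> = emeasure (PiM UNIV ?D) ?box"
    using finite_J A_sets prob_D by (simp add: emeasure_PiM_emb)
  finally show "emeasure (PiM UNIV ?D) ?box
      = emeasure (distr (PiM UNIV M) (PiM UNIV N) (\<lambda>w i. f i (w i))) ?box" ..
qed

section \<open>Measures with full support\<close>

definition full_support :: "'a::topological_space measure \<Rightarrow> bool" where
  "full_support M \<longleftrightarrow> sets M = sets borel \<and> (\<forall>U. open U \<longrightarrow> U \<noteq> {} \<longrightarrow> emeasure M U \<noteq> 0)"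

lemma full_support_density_lborel:
  fixes f :: "'a::euclidean_space \<Rightarrow> real"
  assumes [measurable]: "f \<in> borel_measurable borel" and f_pos: "\<And>x. f x > 0"
  shows "full_support (density lborel f)"
  unfolding full_support_def
proof (intro conjI allI impI notI)
  fix U :: "'a set"
  assume U_null: "open U" "U \<noteq> {}" "emeasure (density lborel f) U = 0"
  then have "AE x in lborel. x \<in> U \<longrightarrow> ennreal (f x) = 0"
    using null_sets_density_iff[of f lborel U] by (simp add: null_sets_def)
  then have "AE x in lborel. x \<notin> U"
    by eventually_elim (use f_pos in \<open>auto simp: ennreal_eq_0_iff simp flip: not_less\<close>)
  then have "U \<in> null_sets lborel"
    using U_null(1) by (subst (asm) AE_iff_null_sets[symmetric]) auto
  then have "negligible U"
    unfolding negligible_iff_null_sets by (rule null_sets_completionI)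
  then show False
    using open_not_negligible U_null by blast
qed simp

lemma full_support_PiM:
  fixes M :: "'i::countable \<Rightarrow> 'a::second_countable_topology measure"
  assumes prob_M: "\<And>i. prob_space (M i)" and full_support_M: "\<And>i. full_support (M i)"
  shows "full_support (PiM UNIV M)"
  unfolding full_support_def
proof (intro conjI allI impI)
  have sets_M: "sets (M i) = sets borel" for i
    using full_support_M by (simp add: full_support_def)
  then have "sets (PiM UNIV M) = sets (PiM UNIV (\<lambda>_::'i. borel :: 'a measure))"
    by (intro sets_PiM_cong) auto
  then show sets_PiM: "sets (PiM UNIV M) = sets borel"
    by (simp only: sets_PiM_equal_borel)
  have space_M: "space (M i) = UNIV" for i
    using sets_eq_imp_space_eq[OF sets_M] by simp
  fix U :: "('i \<Rightarrow> 'a) set"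
  assume U_open: "open U" "U \<noteq> {}"
  then obtain w where "w \<in> U" by auto
  then obtain X where X_box: "w \<in> Pi\<^sub>E UNIV X" "\<And>i. open (X i)" "finite {i. X i \<noteq> UNIV}"
      "Pi\<^sub>E UNIV X \<subseteq> U"
    using product_topology_open_contains_basis[of "\<lambda>_. euclidean" UNIV U w] U_open(1)
    by (auto simp: euclidean_product_topology)
  let ?J = "{i. X i \<noteq> UNIV}"
  have "Pi\<^sub>E UNIV X = prod_emb UNIV M ?J (Pi\<^sub>E ?J X)"
    by (fastforce simp: prod_emb_def PiE_iff space_M)
  then have "emeasure (PiM UNIV M) (Pi\<^sub>E UNIV X) = (\<Prod>i\<in>?J. emeasure (M i) (X i))"
    using X_box prob_M by (simp add: emeasure_PiM_emb sets_M)
  also have "\<dots> \<noteq> 0"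
    using X_box(1,2,3) full_support_M by (fastforce simp: full_support_def PiE_iff)
  finally have "0 < emeasure (PiM UNIV M) (Pi\<^sub>E UNIV X)"
    by (simp add: zero_less_iff_neq_zero)
  also have "\<dots> \<le> emeasure (PiM UNIV M) U"
    using X_box(4) U_open(1) by (intro emeasure_mono) (simp_all add: sets_PiM)
  finally show "emeasure (PiM UNIV M) U \<noteq> 0" by simp
qed

lemma integral_less_full_support:
  fixes f g :: "'a::topological_space \<Rightarrow> real"
  assumes "finite_measure M" and full_support_M: "full_support M"
    and integrable_fg: "integrable M f" "integrable M g"
    and continuous_fg: "continuous_on UNIV f" "continuous_on UNIV g"
    and f_le_g: "\<And>x. f x \<le> g x" and f_less_g: "f x < g x"
  shows "integral\<^sup>L M f < integral\<^sup>L M g"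
proof (rule finite_measure.integral_less_AE[OF assms(1) integrable_fg])
  have "open {x. f x < g x}"
    by (intro open_Collect_less continuous_fg)
  then show "emeasure M {x. f x < g x} \<noteq> 0" "{x. f x < g x} \<in> sets M"
    using full_support_M f_less_g by (auto simp: full_support_def)
qed (auto intro: f_le_g)

section \<open>Rotation invariance of the standard normal law\<close>

lemma nn_integral_lborel_shear_fst:
  fixes F :: "real \<Rightarrow> real \<Rightarrow> ennreal"
  assumes [measurable]: "case_prod F \<in> borel_measurable (borel \<Otimes>\<^sub>M borel)"
  shows "(\<integral>\<^sup>+x. \<integral>\<^sup>+y. F (x + r * y) y \<partial>lborel \<partial>lborel) = (\<integral>\<^sup>+x. \<integral>\<^sup>+y. F x y \<partial>lborel \<partial>lborel)"
proof -
  have "(\<integral>\<^sup>+x. \<integral>\<^sup>+y. F (x + r * y) y \<partial>lborel \<partial>lborel) = (\<integral>\<^sup>+y. \<integral>\<^sup>+x. F (x + r * y) y \<partial>lborel \<partial>lborel)"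
    by (intro lborel_pair.Fubini') simp
  also have "\<dots> = (\<integral>\<^sup>+y. \<integral>\<^sup>+x. F x y \<partial>lborel \<partial>lborel)"
    using nn_integral_real_affine[of "\<lambda>x. F x y" 1 "r * y" for y] by (simp add: add.commute)
  also have "\<dots> = (\<integral>\<^sup>+x. \<integral>\<^sup>+y. F x y \<partial>lborel \<partial>lborel)"
    by (intro lborel_pair.Fubini'[symmetric]) simp
  finally show ?thesis .
qed

lemma nn_integral_lborel_shear_snd:
  fixes F :: "real \<Rightarrow> real \<Rightarrow> ennreal"
  assumes [measurable]: "case_prod F \<in> borel_measurable (borel \<Otimes>\<^sub>M borel)"
  shows "(\<integral>\<^sup>+x. \<integral>\<^sup>+y. F x (y + r * x) \<partial>lborel \<partial>lborel) = (\<integral>\<^sup>+x. \<integral>\<^sup>+y. F x y \<partial>lborel \<partial>lborel)"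
  using nn_integral_real_affine[of "F x" 1 "r * x" for x] by (simp add: add.commute)

lemma nn_integral_lborel_point_reflection:
  fixes F :: "real \<Rightarrow> real \<Rightarrow> ennreal"
  assumes [measurable]: "case_prod F \<in> borel_measurable (borel \<Otimes>\<^sub>M borel)"
  shows "(\<integral>\<^sup>+x. \<integral>\<^sup>+y. F (- x) (- y) \<partial>lborel \<partial>lborel) = (\<integral>\<^sup>+x. \<integral>\<^sup>+y. F x y \<partial>lborel \<partial>lborel)"
  using nn_integral_real_affine[of "F (- x)" "-1" 0 for x]
    nn_integral_real_affine[of "\<lambda>x. \<integral>\<^sup>+y. F x y \<partial>lborel" "-1" 0] by simp

lemma rotation_eq_shears:
  fixes c s t :: real
  assumes "c\<^sup>2 + s\<^sup>2 = 1" "s \<noteq> 0"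
  defines "t \<equiv> (1 - c) / s"
  shows "s * x + c * y = y + s * (x - t * y)"
    and "c * x - s * y = x - t * y - t * (y + s * (x - t * y))"
proof -
  have t_mult_s: "t * s = 1 - c"
    using assms(2) by (simp add: t_def)
  have "t * (1 + c) = (1 - c\<^sup>2) / s"
    by (simp add: t_def power2_eq_square algebra_simps)
  also have "1 - c\<^sup>2 = s\<^sup>2"
    using assms(1) by simp
  finally have t_mult_1_plus_c: "t * (1 + c) = s"
    using assms(2) by (simp add: power2_eq_square)
  have "y + s * (x - t * y) = s * x + (1 - t * s) * y"
    by (simp add: algebra_simps)
  then show snd_eq: "s * x + c * y = y + s * (x - t * y)"
    by (simp add: t_mult_s)
  have "x - t * y - t * (s * x + c * y) = (1 - t * s) * x - t * (1 + c) * y"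
    by (simp add: algebra_simps)
  then show "c * x - s * y = x - t * y - t * (y + s * (x - t * y))"
    by (simp add: t_mult_s t_mult_1_plus_c snd_eq[symmetric])
qed

lemma nn_integral_lborel_rotate:
  fixes F :: "real \<Rightarrow> real \<Rightarrow> ennreal"
  assumes [measurable]: "case_prod F \<in> borel_measurable (borel \<Otimes>\<^sub>M borel)" and circle: "c\<^sup>2 + s\<^sup>2 = 1"
  shows "(\<integral>\<^sup>+x. \<integral>\<^sup>+y. F (c * x - s * y) (s * x + c * y) \<partial>lborel \<partial>lborel)
       = (\<integral>\<^sup>+x. \<integral>\<^sup>+y. F x y \<partial>lborel \<partial>lborel)"
proof (cases "s = 0")
  case True
  then have "c = 1 \<or> c = -1"
    using circle by (simp add: power2_eq_1_iff)
  then show ?thesis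
    using True nn_integral_lborel_point_reflection[OF assms(1)] by auto
next
  case False
  define t where "t = (1 - c) / s"
  define G where "G x y = F (x - t * y) y" for x y
  define H where "H x y = G x (y + s * x)" for x y
  have [measurable]: "case_prod G \<in> borel_measurable (borel \<Otimes>\<^sub>M borel)"
    "case_prod H \<in> borel_measurable (borel \<Otimes>\<^sub>M borel)"
    unfolding G_def H_def by measurable
  have "F (c * x - s * y) (s * x + c * y) = H (x + (- t) * y) y" for x y
    using rotation_eq_shears[OF circle False, of x y] by (simp add: G_def H_def t_def)
  then have "(\<integral>\<^sup>+x. \<integral>\<^sup>+y. F (c * x - s * y) (s * x + c * y) \<partial>lborel \<partial>lborel)
      = (\<integral>\<^sup>+x. \<integral>\<^sup>+y. H (x + (- t) * y) y \<partial>lborel \<partial>lborel)"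
    by (simp only:)
  also have "\<dots> = (\<integral>\<^sup>+x. \<integral>\<^sup>+y. H x y \<partial>lborel \<partial>lborel)"
    by (rule nn_integral_lborel_shear_fst) measurable
  also have "\<dots> = (\<integral>\<^sup>+x. \<integral>\<^sup>+y. G x y \<partial>lborel \<partial>lborel)"
    unfolding H_def by (rule nn_integral_lborel_shear_snd) measurable
  also have "\<dots> = (\<integral>\<^sup>+x. \<integral>\<^sup>+y. F x y \<partial>lborel \<partial>lborel)"
    using nn_integral_lborel_shear_fst[OF assms(1), of "- t"] by (simp add: G_def)
  finally show ?thesis .
qed

abbreviation std_normal :: "real measure" where
  "std_normal \<equiv> density lborel std_normal_density"

lemma prob_space_std_normal: "prob_space std_normal"
  by (rule prob_space_normal_density) simp

lemma nn_integral_std_normal_rotate: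
  fixes F :: "real \<Rightarrow> real \<Rightarrow> ennreal"
  assumes [measurable]: "case_prod F \<in> borel_measurable (borel \<Otimes>\<^sub>M borel)" and circle: "c\<^sup>2 + s\<^sup>2 = 1"
  shows "(\<integral>\<^sup>+x. \<integral>\<^sup>+y. F (c * x - s * y) (s * x + c * y) \<partial>std_normal \<partial>std_normal)
       = (\<integral>\<^sup>+x. \<integral>\<^sup>+y. F x y \<partial>std_normal \<partial>std_normal)"
proof -
  let ?\<phi> = "\<lambda>x y. ennreal (std_normal_density x * std_normal_density y)"
  have density: "(\<integral>\<^sup>+x. \<integral>\<^sup>+y. H x y \<partial>std_normal \<partial>std_normal)
      = (\<integral>\<^sup>+x. \<integral>\<^sup>+y. ?\<phi> x y * H x y \<partial>lborel \<partial>lborel)"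
    if [measurable]: "case_prod H \<in> borel_measurable (borel \<Otimes>\<^sub>M borel)"
      for H :: "real \<Rightarrow> real \<Rightarrow> ennreal"
    by (simp add: nn_integral_density nn_integral_cmult[symmetric] ennreal_mult' mult.assoc)
  have "?\<phi> (c * x - s * y) (s * x + c * y) = ?\<phi> x y" for x y
  proof -
    have "(c * x - s * y)\<^sup>2 + (s * x + c * y)\<^sup>2 = (c\<^sup>2 + s\<^sup>2) * (x\<^sup>2 + y\<^sup>2)"
      by (simp add: power2_eq_square algebra_simps)
    then have "- (c * x - s * y)\<^sup>2 / 2 + - (s * x + c * y)\<^sup>2 / 2 = - x\<^sup>2 / 2 + - y\<^sup>2 / 2"
      using circle by (simp add: field_simps)
    then show ?thesis
      unfolding std_normal_density_def mult.assoc mult.left_commute[of "exp _"] mult_exp_exp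
      by (simp only:)
  qed
  then have "(\<integral>\<^sup>+x. \<integral>\<^sup>+y. F (c * x - s * y) (s * x + c * y) \<partial>std_normal \<partial>std_normal)
      = (\<integral>\<^sup>+x. \<integral>\<^sup>+y. ?\<phi> (c * x - s * y) (s * x + c * y) * F (c * x - s * y) (s * x + c * y) \<partial>lborel \<partial>lborel)"
    by (simp only:) (rule density, measurable)
  also have "\<dots> = (\<integral>\<^sup>+x. \<integral>\<^sup>+y. ?\<phi> x y * F x y \<partial>lborel \<partial>lborel)"
    by (rule nn_integral_lborel_rotate[OF _ circle]) measurable
  also have "\<dots> = (\<integral>\<^sup>+x. \<integral>\<^sup>+y. F x y \<partial>std_normal \<partial>std_normal)"
    by (rule density[symmetric]) measurable
  finally show ?thesis .
qed

abbreviation white_noise :: "('i \<Rightarrow> real) measure" where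
  "white_noise \<equiv> PiM UNIV (\<lambda>_. std_normal)"

lemma prob_space_white_noise: "prob_space white_noise"
  by (intro prob_space_PiM prob_space_std_normal)

lemma space_white_noise [simp]: "space white_noise = UNIV"
  by (simp add: space_PiM PiE_UNIV_domain)

definition givens :: "real \<Rightarrow> real \<Rightarrow> 'i \<Rightarrow> 'i \<Rightarrow> ('i \<Rightarrow> real) \<Rightarrow> 'i \<Rightarrow> real" where
  "givens c s a b x = x(a := c * x a - s * x b, b := s * x a + c * x b)"

lemma measurable_fun_upd_white_noise [measurable (raw)]:
  assumes "f \<in> M \<rightarrow>\<^sub>M white_noise" "g \<in> borel_measurable M"
  shows "(\<lambda>x. (f x)(i := g x)) \<in> M \<rightarrow>\<^sub>M white_noise"
  using assms by (intro measurable_fun_upd[where J=UNIV]) auto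

lemma measurable_givens [measurable]: "givens c s a b \<in> white_noise \<rightarrow>\<^sub>M white_noise"
  unfolding givens_def by measurable

lemma nn_integral_white_noise_givens:
  assumes f_measurable [measurable]: "f \<in> borel_measurable white_noise" and "a \<noteq> b"
    and circle: "c\<^sup>2 + s\<^sup>2 = 1"
  shows "(\<integral>\<^sup>+w. f (givens c s a b w) \<partial>white_noise) = (\<integral>\<^sup>+w. f w \<partial>white_noise)"
proof -
  have resample: "(\<integral>\<^sup>+w. h w \<partial>white_noise)
      = (\<integral>\<^sup>+w. \<integral>\<^sup>+x. \<integral>\<^sup>+y. h (w(a := x, b := y)) \<partial>std_normal \<partial>std_normal \<partial>white_noise)"
    if [measurable]: "h \<in> borel_measurable white_noise" for h :: "('a \<Rightarrow> real) \<Rightarrow> ennreal"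
  proof -
    interpret std_normal: prob_space std_normal by (rule prob_space_std_normal)
    have "(\<integral>\<^sup>+w. h w \<partial>white_noise) = (\<integral>\<^sup>+w. \<integral>\<^sup>+y. h (w(b := y)) \<partial>std_normal \<partial>white_noise)"
      by (rule nn_integral_PiM_fun_upd[OF prob_space_std_normal]) measurable
    also have "\<dots> = (\<integral>\<^sup>+w. \<integral>\<^sup>+x. \<integral>\<^sup>+y. h (w(a := x, b := y)) \<partial>std_normal \<partial>std_normal \<partial>white_noise)"
      by (rule nn_integral_PiM_fun_upd[OF prob_space_std_normal]) measurable
    finally show ?thesis .
  qed
  have "(\<integral>\<^sup>+x. \<integral>\<^sup>+y. f (givens c s a b (w(a := x, b := y))) \<partial>std_normal \<partial>std_normal)
      = (\<integral>\<^sup>+x. \<integral>\<^sup>+y. f (w(a := x, b := y)) \<partial>std_normal \<partial>std_normal)" for w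
  proof -
    have "givens c s a b (w(a := x, b := y)) = w(a := c * x - s * y, b := s * x + c * y)" for x y
      using \<open>a \<noteq> b\<close> by (auto simp: givens_def)
    then show ?thesis
      using nn_integral_std_normal_rotate[OF _ circle, of "\<lambda>x y. f (w(a := x, b := y))"] by simp
  qed
  then have "(\<integral>\<^sup>+w. f (givens c s a b w) \<partial>white_noise)
      = (\<integral>\<^sup>+w. \<integral>\<^sup>+x. \<integral>\<^sup>+y. f (w(a := x, b := y)) \<partial>std_normal \<partial>std_normal \<partial>white_noise)"
    by (subst resample) simp_all
  also have "\<dots> = (\<integral>\<^sup>+w. f w \<partial>white_noise)"
    by (rule resample[symmetric]) measurable
  finally show ?thesis .
qed

lemma ex_rotation_annihilating:
  fixes x y :: real
  obtains c s where "c\<^sup>2 + s\<^sup>2 = 1" "s * x + c * y = 0"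
proof (cases "x\<^sup>2 + y\<^sup>2 = 0")
  case True
  then show thesis
    using that[of 1 0] by simp
next
  case False
  define r where "r = sqrt (x\<^sup>2 + y\<^sup>2)"
  have "(x / r)\<^sup>2 + (- y / r)\<^sup>2 = 1" "(- y / r) * x + (x / r) * y = 0"
    using False by (simp_all add: r_def power_divide flip: add_divide_distrib)
  then show thesis by (rule that)
qed

section \<open>Moments of positive random variables\<close>

lemma exp_less_interpolation:
  fixes y t :: real
  assumes "0 < t" "t < 1" "y \<noteq> 0"
  shows "exp (t * y) < t * exp y + (1 - t)"
proof -
  have strict: "1 + u < exp u" if "u \<noteq> 0" for u :: real
    using exp_minus_greater[of "- u"] that by simp
  have "1 = t * (1 + (1 - t) * y) + (1 - t) * (1 + - t * y)"
    by (simp add: algebra_simps)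
  also have "\<dots> < t * exp ((1 - t) * y) + (1 - t) * exp (- t * y)"
    using assms by (intro add_strict_mono mult_strict_left_mono strict) auto
  finally have "exp (t * y) * 1 < exp (t * y) * (t * exp ((1 - t) * y) + (1 - t) * exp (- t * y))"
    by (rule mult_strict_left_mono) simp
  also have "\<dots> = t * exp y + (1 - t)"
    by (simp add: distrib_left mult.left_commute mult_exp_exp algebra_simps)
  finally show ?thesis by simp
qed

lemma exp_le_interpolation:
  fixes y t :: real
  assumes "0 \<le> t" "t \<le> 1"
  shows "exp (t * y) \<le> t * exp y + (1 - t)"
  using exp_less_interpolation[of t y] assms by (cases "t = 0 \<or> t = 1 \<or> y = 0") auto

lemma exp_difference_quotient_bounds:
  fixes y t :: real
  assumes "0 < t" "t \<le> 1"
  shows "y \<le> (exp (t * y) - 1) / t" "(exp (t * y) - 1) / t \<le> exp y"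
proof -
  have "t * y \<le> exp (t * y) - 1"
    using exp_ge_add_one_self[of "t * y"] by linarith
  then show "y \<le> (exp (t * y) - 1) / t"
    using assms by (simp add: pos_le_divide_eq mult.commute)
  have "exp (t * y) - 1 \<le> t * exp y"
    using exp_le_interpolation[of t y] assms by simp
  then show "(exp (t * y) - 1) / t \<le> exp y"
    using assms by (simp add: pos_divide_le_eq mult.commute)
qed

lemma exp_difference_quotient_tendsto:
  fixes y :: real
  shows "(\<lambda>n. (exp (inverse (real (Suc n)) * y) - 1) / inverse (real (Suc n))) \<longlonglongrightarrow> y"
proof -
  have "((\<lambda>t. exp (t * y)) has_real_derivative y) (at 0)"
    by (auto intro!: derivative_eq_intros)
  then have "((\<lambda>t. (exp (t * y) - 1) / t) \<longlongrightarrow> y) (at 0)"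
    by (simp add: has_field_derivative_iff)
  moreover have "filterlim (\<lambda>n. inverse (real (Suc n))) (at 0) sequentially"
    by (intro filterlim_atI LIMSEQ_inverse_real_of_nat) simp
  ultimately show ?thesis by (rule filterlim_compose)
qed

context prob_space
begin

lemma integrable_exp_mult:
  fixes Y :: "'a \<Rightarrow> real"
  assumes [measurable]: "Y \<in> borel_measurable M" and "integrable M (\<lambda>x. exp (Y x))"
    and t_bounds: "0 \<le> t" "t \<le> 1"
  shows "integrable M (\<lambda>x. exp (t * Y x))"
proof (rule Bochner_Integration.integrable_bound)
  show "integrable M (\<lambda>x. t * exp (Y x) + (1 - t))" using assms by auto
  show "AE x in M. norm (exp (t * Y x)) \<le> norm (t * exp (Y x) + (1 - t))"
    using exp_le_interpolation[OF t_bounds]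
    by (intro AE_I2) (auto intro: order_trans[OF _ abs_ge_self])
qed simp

lemma expectation_exp_difference_quotient_tendsto:
  fixes Y :: "'a \<Rightarrow> real"
  assumes integrable_Y: "integrable M Y" and integrable_exp_Y: "integrable M (\<lambda>x. exp (Y x))"
  shows "(\<lambda>n. (expectation (\<lambda>x. exp (inverse (real (Suc n)) * Y x)) - 1) / inverse (real (Suc n)))
    \<longlonglongrightarrow> expectation Y"
proof -
  have [measurable]: "Y \<in> borel_measurable M" using integrable_Y by auto
  let ?t = "\<lambda>n. inverse (real (Suc n))"
  let ?q = "\<lambda>n x. (exp (?t n * Y x) - 1) / ?t n"
  have t_bounds: "0 < ?t n" "?t n \<le> 1" for n
    by (simp_all add: inverse_le_1_iff)
  have "(\<lambda>n. expectation (?q n)) \<longlonglongrightarrow> expectation Y"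
  proof (rule integral_dominated_convergence)
    show "integrable M (\<lambda>x. \<bar>Y x\<bar> + exp (Y x))" using integrable_Y integrable_exp_Y by auto
    show "AE x in M. (\<lambda>n. ?q n x) \<longlonglongrightarrow> Y x"
      by (intro AE_I2 exp_difference_quotient_tendsto)
    show "AE x in M. norm (?q n x) \<le> \<bar>Y x\<bar> + exp (Y x)" for n
    proof (intro AE_I2)
      fix x
      show "norm (?q n x) \<le> \<bar>Y x\<bar> + exp (Y x)"
        using exp_difference_quotient_bounds[OF t_bounds[of n], of "Y x"] exp_gt_zero[of "Y x"]
        unfolding real_norm_def by linarith
    qed
  qed measurable
  moreover have "expectation (?q n) = (expectation (\<lambda>x. exp (?t n * Y x)) - 1) / ?t n" for n
    using integrable_exp_mult[of Y "?t n"] integrable_exp_Y t_bounds[of n] by (simp add: prob_space)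
  ultimately show ?thesis by simp
qed

lemma expectation_exp_less:
  fixes Y :: "'a \<Rightarrow> real"
  assumes "integrable M Y" "integrable M (\<lambda>x. exp (Y x))" "\<epsilon> > 0"
  obtains t where "0 < t" "t \<le> 1" "expectation (\<lambda>x. exp (t * Y x)) < exp (t * (expectation Y + \<epsilon>))"
proof -
  have "\<forall>\<^sub>F n in sequentially.
      (expectation (\<lambda>x. exp (inverse (real (Suc n)) * Y x)) - 1) / inverse (real (Suc n))
      < expectation Y + \<epsilon>"
    using \<open>\<epsilon> > 0\<close>
    by (intro order_tendstoD[OF expectation_exp_difference_quotient_tendsto[OF assms(1,2)]]) simp
  then obtain n where quotient_less:
      "(expectation (\<lambda>x. exp (inverse (real (Suc n)) * Y x)) - 1) / inverse (real (Suc n))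
        < expectation Y + \<epsilon>"
    by (auto simp: eventually_sequentially)
  define t where "t = inverse (real (Suc n))"
  have t_bounds: "0 < t" "t \<le> 1" by (simp_all add: t_def inverse_le_1_iff)
  then have "expectation (\<lambda>x. exp (t * Y x)) < 1 + t * (expectation Y + \<epsilon>)"
    using quotient_less[folded t_def] by (simp add: pos_divide_less_eq mult.commute)
  also have "\<dots> \<le> exp (t * (expectation Y + \<epsilon>))"
    by (rule exp_ge_add_one_self)
  finally show ?thesis by (rule that[OF t_bounds])
qed

end

definition moment :: "'a measure \<Rightarrow> ('a \<Rightarrow> real) \<Rightarrow> real \<Rightarrow> real" where
  "moment M R s = (\<integral>x. R x powr s \<partial>M)"

lemma moment_nonneg [simp]: "moment M R s \<ge> 0"
  by (simp add: moment_def)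

locale positive_rv = prob_space +
  fixes R :: "'a \<Rightarrow> real" and \<delta> :: real
  assumes R_measurable [measurable]: "R \<in> borel_measurable M"
    and AE_R_pos: "AE x in M. R x > 0"
    and \<delta>_pos: "\<delta> > 0"
    and integrable_powr: "s \<ge> - \<delta> \<Longrightarrow> integrable M (\<lambda>x. R x powr s)"
    and R_exceeds_1: "emeasure M {x \<in> space M. R x > 1} \<noteq> 0"
begin

lemma AE_powr_eq_exp: "AE x in M. R x powr s = exp (s * ln (R x))"
  using AE_R_pos by eventually_elim (simp add: powr_def)

lemma moment_eq_exp: "moment M R s = expectation (\<lambda>x. exp (s * ln (R x)))"
  unfolding moment_def using AE_powr_eq_exp by (intro integral_cong_AE) auto

lemma integrable_exp_ln: "s \<ge> - \<delta> \<Longrightarrow> integrable M (\<lambda>x. exp (s * ln (R x)))"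
  using integrable_powr[of s] AE_powr_eq_exp[of s] by (subst integrable_cong_AE[symmetric]) auto

lemma integrable_ln: "integrable M (\<lambda>x. ln (R x))"
proof (rule Bochner_Integration.integrable_bound)
  show "integrable M (\<lambda>x. exp (1 * ln (R x)) + exp (- \<delta> * ln (R x)) / \<delta>)"
    using integrable_exp_ln[of 1] integrable_exp_ln[of "- \<delta>"] \<delta>_pos by auto
  have "\<bar>y\<bar> \<le> exp (1 * y) + exp (- \<delta> * y) / \<delta>" for y :: real
  proof -
    have "y \<le> exp (1 * y)" "\<delta> * (- y) \<le> exp (- \<delta> * y)"
      using exp_ge_add_one_self[of "1 * y"] exp_ge_add_one_self[of "- \<delta> * y"] by linarith+
    moreover from this(2) have "- y \<le> exp (- \<delta> * y) / \<delta>"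
      using \<delta>_pos by (simp only: pos_le_divide_eq mult.commute)
    moreover have "0 < exp (1 * y)" "0 < exp (- \<delta> * y) / \<delta>"
      using \<delta>_pos by simp_all
    ultimately show ?thesis by linarith
  qed
  then show "AE x in M. norm (ln (R x)) \<le> norm (exp (1 * ln (R x)) + exp (- \<delta> * ln (R x)) / \<delta>)"
    by (auto intro: order_trans[OF _ abs_ge_self])
qed simp

lemma moment_0: "moment M R 0 = 1"
  by (simp add: moment_eq_exp prob_space)

lemma moment_pos:
  assumes "s \<ge> - \<delta>"
  shows "moment M R s > 0"
proof -
  have "expectation (\<lambda>x. 0) < expectation (\<lambda>x. exp (s * ln (R x)))"
    by (rule integral_less_AE_space) (use integrable_exp_ln[OF assms] emeasure_space_1 in auto)
  then show ?thesis by (simp add: moment_eq_exp)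
qed

text \<open>The slope of the moment function at 0 is the expectation of \<open>ln R\<close>, here in the one-sided forms
  that serve as Chernoff bounds.\<close>

lemma ex_moment_less:
  assumes "\<epsilon> > 0"
  obtains s where "s > 0" "moment M R s < exp (s * (expectation (\<lambda>x. ln (R x)) + \<epsilon>))"
proof -
  have "integrable M (\<lambda>x. exp (ln (R x)))"
    using integrable_exp_ln[of 1] \<delta>_pos by simp
  then show thesis
    using integrable_ln assms that
    by (elim expectation_exp_less[rotated]) (auto simp: moment_eq_exp)
qed

lemma ex_moment_neg_less:
  assumes "\<epsilon> > 0"
  obtains s where "s > 0" "s \<le> \<delta>" "moment M R (- s) < exp (- s * (expectation (\<lambda>x. ln (R x)) - \<epsilon>))"
proof -
  have "integrable M (\<lambda>x. exp (- \<delta> * ln (R x)))" "\<delta> * \<epsilon> > 0"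
    using integrable_exp_ln[of "- \<delta>"] \<delta>_pos assms by simp_all
  then obtain t where t_props: "0 < t" "t \<le> 1"
    "expectation (\<lambda>x. exp (t * (- \<delta> * ln (R x))))
        < exp (t * (expectation (\<lambda>x. - \<delta> * ln (R x)) + \<delta> * \<epsilon>))"
    using integrable_ln by (elim expectation_exp_less[rotated]) auto
  have "t * (- \<delta> * expectation (\<lambda>x. ln (R x)) + \<delta> * \<epsilon>)
      = - (t * \<delta>) * (expectation (\<lambda>x. ln (R x)) - \<epsilon>)"
    by (simp add: algebra_simps)
  then have "moment M R (- (t * \<delta>)) < exp (- (t * \<delta>) * (expectation (\<lambda>x. ln (R x)) - \<epsilon>))"
    using t_props(3) by (simp add: moment_eq_exp mult.assoc)
  then show thesis
    using t_props \<delta>_pos by (intro that[of "t * \<delta>"]) (auto simp: mult_left_le_one_le)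
qed

lemma moment_less_interpolation:
  assumes "0 < s" "s < t"
  shows "moment M R s < s / t * moment M R t + (1 - s / t)"
proof -
  define r where "r = s / t"
  have r_bounds: "0 < r" "r < 1" and s_eq: "s = r * t"
    using assms by (auto simp: r_def)
  have integrable_exp: "integrable M (\<lambda>x. exp (s * ln (R x)))"
      "integrable M (\<lambda>x. exp (t * ln (R x)))"
    using integrable_exp_ln[of s] integrable_exp_ln[of t] assms \<delta>_pos by auto
  have "moment M R s < expectation (\<lambda>x. r * exp (t * ln (R x)) + (1 - r))"
    unfolding moment_eq_exp
  proof (rule integral_less_AE)
    show "integrable M (\<lambda>x. exp (s * ln (R x)))"
        "integrable M (\<lambda>x. r * exp (t * ln (R x)) + (1 - r))"
      using integrable_exp by auto
    show "emeasure M {x \<in> space M. R x > 1} \<noteq> 0" by (rule R_exceeds_1)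
    show "AE x in M. exp (s * ln (R x)) \<le> r * exp (t * ln (R x)) + (1 - r)"
      using exp_le_interpolation[of r "t * ln (R x)" for x] r_bounds by (simp add: s_eq mult.assoc)
    show "AE x in M. x \<in> {x \<in> space M. R x > 1} \<longrightarrow> exp (s * ln (R x))
        \<noteq> r * exp (t * ln (R x)) + (1 - r)"
    proof (intro AE_I2 impI)
      fix x assume "x \<in> {x \<in> space M. R x > 1}"
      then have "t * ln (R x) \<noteq> 0" using assms by simp
      then show "exp (s * ln (R x)) \<noteq> r * exp (t * ln (R x)) + (1 - r)"
        using exp_less_interpolation[OF r_bounds, of "t * ln (R x)"] by (simp add: s_eq mult.assoc)
    qed
  qed measurable
  also have "\<dots> = r * moment M R t + (1 - r)"
    using integrable_exp by (simp add: moment_eq_exp prob_space)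
  finally show ?thesis by (simp add: r_def)
qed

lemma moment_less_1:
  assumes "0 < s" "s < t" "moment M R t \<le> 1"
  shows "moment M R s < 1"
proof -
  have "s / t * moment M R t \<le> s / t * 1"
    using assms by (intro mult_left_mono) auto
  then show ?thesis
    using moment_less_interpolation[OF assms(1,2)] by linarith
qed

lemma convex_on_moment: "convex_on {- \<delta>..} (moment M R)"
proof (rule convex_onI)
  fix r s t :: real
  assume r_bounds: "0 < r" "r < 1" and "s \<in> {- \<delta>..}" "t \<in> {- \<delta>..}"
  then have integrable_exp: "integrable M (\<lambda>x. exp (s * ln (R x)))"
      "integrable M (\<lambda>x. exp (t * ln (R x)))"
    by (auto intro: integrable_exp_ln)
  have "(1 - r) *\<^sub>R s + r *\<^sub>R t \<in> {- \<delta>..}"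
    using r_bounds \<open>s \<in> _\<close> \<open>t \<in> _\<close> by (intro convexD) auto
  then have "integrable M (\<lambda>x. exp (((1 - r) * s + r * t) * ln (R x)))"
    by (auto intro: integrable_exp_ln)
  then have "moment M R ((1 - r) * s + r * t)
      \<le> expectation (\<lambda>x. (1 - r) * exp (s * ln (R x)) + r * exp (t * ln (R x)))"
    unfolding moment_eq_exp
  proof (rule integral_mono)
    show "exp (((1 - r) * s + r * t) * ln (R x))
        \<le> (1 - r) * exp (s * ln (R x)) + r * exp (t * ln (R x))" for x
      using convex_onD[OF exp_convex, of r "s * ln (R x)" "t * ln (R x)"] r_bounds
      by (simp add: algebra_simps)
  qed (use integrable_exp in auto)
  also have "\<dots> = (1 - r) * moment M R s + r * moment M R t"
    using integrable_exp by (simp add: moment_eq_exp)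
  finally show "moment M R ((1 - r) *\<^sub>R s + r *\<^sub>R t) \<le> (1 - r) * moment M R s + r * moment M R t"
    by simp
qed simp

lemma continuous_on_moment: "continuous_on {- \<delta><..} (moment M R)"
  by (intro convex_on_continuous convex_on_subset[OF convex_on_moment]) auto

lemma ex_moment_gt_1: "\<exists>s>0. moment M R s > 1"
proof -
  let ?E = "expectation (\<lambda>x. max 0 (ln (R x)))"
  have integrable_pos_ln: "integrable M (\<lambda>x. max 0 (ln (R x)))"
    using integrable_ln by auto
  have "expectation (\<lambda>x. 0) < ?E"
  proof (rule integral_less_AE)
    show "emeasure M {x \<in> space M. R x > 1} \<noteq> 0" by (rule R_exceeds_1)
  qed (use integrable_pos_ln in auto)
  then have "?E > 0" by simp
  define s where "s = 2 / ?E"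
  have s_props: "s > 0" "1 < s * ?E" using \<open>?E > 0\<close> by (simp_all add: s_def)
  have "s * ?E = expectation (\<lambda>x. s * max 0 (ln (R x)))"
    using integrable_pos_ln by simp
  also have "\<dots> \<le> moment M R s"
    unfolding moment_eq_exp
  proof (rule integral_mono)
    show "s * max 0 (ln (R x)) \<le> exp (s * ln (R x))" for x
    proof -
      have "s * ln (R x) \<le> exp (s * ln (R x))"
        using exp_ge_add_one_self[of "s * ln (R x)"] by linarith
      then show ?thesis by (simp add: max_def)
    qed
  qed (use integrable_pos_ln integrable_exp_ln[of s] s_props \<delta>_pos in auto)
  finally show ?thesis using s_props by (intro exI[of _ s]) auto
qed

lemma ex1_moment_eq_1:
  assumes "expectation (\<lambda>x. ln (R x)) < 0"
  shows "\<exists>!\<alpha>. \<alpha> > 0 \<and> moment M R \<alpha> = 1"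
proof (rule ex_ex1I)
  obtain s where below: "s > 0" "moment M R s < 1"
    using ex_moment_less[of "- expectation (\<lambda>x. ln (R x))"] assms by auto
  obtain t where above: "t > 0" "moment M R t > 1"
    using ex_moment_gt_1 by blast
  have "s \<le> t"
    using moment_less_1[of t s] below above by (cases s t rule: linorder_cases) auto
  moreover have "continuous_on {s..t} (moment M R)"
    using below \<delta>_pos by (intro continuous_on_subset[OF continuous_on_moment]) auto
  ultimately obtain \<alpha> where "s \<le> \<alpha>" "moment M R \<alpha> = 1"
    using IVT'[of "moment M R" s 1 t] below above by auto
  then show "\<exists>\<alpha>. \<alpha> > 0 \<and> moment M R \<alpha> = 1" using below by (intro exI[of _ \<alpha>]) auto
next
  fix \<alpha> \<beta> assume "\<alpha> > 0 \<and> moment M R \<alpha> = 1" "\<beta> > 0 \<and> moment M R \<beta> = 1"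
  then show "\<alpha> = \<beta>"
    using moment_less_1[of \<alpha> \<beta>] moment_less_1[of \<beta> \<alpha>] by (cases \<alpha> \<beta> rule: linorder_cases) auto
qed

lemma less_moment_root:
  assumes "\<alpha> > 0" "moment M R \<alpha> = 1" "moment M R s < 1"
  shows "s < \<alpha>"
  using moment_less_1[of \<alpha> s] assms by (cases s \<alpha> rule: linorder_cases) auto

lemma moment_root_less:
  assumes "moment M R \<alpha> = 1" "s > 0" "moment M R s > 1"
  shows "\<alpha> < s"
  using moment_less_1[of s \<alpha>] assms by (cases s \<alpha> rule: linorder_cases) auto

end

section \<open>Euclidean norms\<close>

lemma L2_set_power2: "(L2_set f A)\<^sup>2 = (\<Sum>i\<in>A. (f i)\<^sup>2)"
  by (simp add: L2_set_def sum_nonneg)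

lemma L2_set_cmult: "L2_set (\<lambda>i. c * f i) A = \<bar>c\<bar> * L2_set f A"
  by (simp add: L2_set_def power_mult_distrib real_sqrt_mult flip: sum_distrib_left)

lemma abs_le_L2_set: "finite A \<Longrightarrow> i \<in> A \<Longrightarrow> \<bar>f i\<bar> \<le> L2_set f A"
  using member_le_L2_set[of A i "\<lambda>i. \<bar>f i\<bar>"] by (simp add: L2_set_def)

lemma L2_set_indicator_singleton:
  assumes "finite A" "j \<in> A"
  shows "L2_set (indicator {j}) A = 1"
proof -
  have "(\<Sum>i\<in>A. (indicator {j} i)\<^sup>2) = (\<Sum>i\<in>A. of_bool (i = j) :: real)"
    by (intro sum.cong) (auto simp: indicator_def)
  then show ?thesis
    using assms by (simp add: L2_set_def)
qed

lemma L2_set_sum_le: "L2_set (\<lambda>i. \<Sum>j\<in>J. f j i) A \<le> (\<Sum>j\<in>J. L2_set (f j) A)"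
proof (induction J rule: infinite_finite_induct)
  case (insert j J)
  then show ?case
    using L2_set_triangle_ineq[of "f j" "\<lambda>i. \<Sum>j\<in>J. f j i" A] by simp
qed (simp_all add: L2_set_0')

lemma L2_set_add_less:
  assumes "finite A" "r \<in> A" "f r > 0" "g r < 0"
  shows "L2_set (\<lambda>i. f i + g i) A < L2_set f A + L2_set g A"
proof (rule power2_less_imp_less)
  have "(\<Sum>i\<in>A. f i * g i) < (\<Sum>i\<in>A. \<bar>f i\<bar> * \<bar>g i\<bar>)"
  proof (rule sum_strict_mono_ex1)
    show "\<forall>i\<in>A. f i * g i \<le> \<bar>f i\<bar> * \<bar>g i\<bar>"
      by (simp add: abs_ge_self flip: abs_mult)
    have "f r * g r < \<bar>f r * g r\<bar>"
      using mult_pos_neg[OF assms(3,4)] by simp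
    then show "\<exists>i\<in>A. f i * g i < \<bar>f i\<bar> * \<bar>g i\<bar>"
      using assms(2) by (auto simp: abs_mult)
  qed (rule assms(1))
  also have "\<dots> \<le> L2_set f A * L2_set g A"
    by (rule L2_set_mult_ineq)
  finally have "(\<Sum>i\<in>A. f i * g i) < L2_set f A * L2_set g A" .
  moreover have "(L2_set (\<lambda>i. f i + g i) A)\<^sup>2
      = (L2_set f A)\<^sup>2 + (L2_set g A)\<^sup>2 + 2 * (\<Sum>i\<in>A. f i * g i)"
    by (simp add: L2_set_power2 power2_sum sum.distrib sum_distrib_left mult.assoc)
  ultimately show "(L2_set (\<lambda>i. f i + g i) A)\<^sup>2 < (L2_set f A + L2_set g A)\<^sup>2"
    by (simp add: power2_sum)
qed simp

lemma L2_set_sum_less: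
  assumes "finite A" "r \<in> A" and indices: "finite J" "j \<in> J" "k \<in> J"
    and signs: "f j r > 0" "f k r < 0"
  shows "L2_set (\<lambda>i. \<Sum>j\<in>J. f j i) A < (\<Sum>j\<in>J. L2_set (f j) A)"
proof -
  have "j \<noteq> k" using signs by auto
  then have split: "(\<Sum>i\<in>J. h i) = h j + h k + (\<Sum>i\<in>J - {j} - {k}. h i)" for h :: "'b \<Rightarrow> real"
    using indices by (simp add: sum.remove[of J j] sum.remove[of "J - {j}" k])
  have "L2_set (\<lambda>i. \<Sum>j\<in>J. f j i) A
      \<le> L2_set (\<lambda>i. f j i + f k i) A + L2_set (\<lambda>i. \<Sum>l\<in>J - {j} - {k}. f l i) A"
    unfolding split by (rule L2_set_triangle_ineq)
  also have "\<dots> < L2_set (f j) A + L2_set (f k) A + (\<Sum>l\<in>J - {j} - {k}. L2_set (f l) A)"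
    using assms by (intro add_less_le_mono L2_set_add_less[of A r] L2_set_sum_le) auto
  finally show ?thesis
    by (simp only: split)
qed

lemma convex_on_powr_atLeast:
  fixes p :: real
  assumes "p \<ge> 1"
  shows "convex_on {0..} (\<lambda>x. x powr p)"
proof (rule convex_onI)
  fix t x y :: real
  assume t_bounds: "0 < t" "t < 1" and xy_nonneg: "x \<in> {0..}" "y \<in> {0..}"
  have shrink: "(r * z) powr p \<le> r * z powr p" if "0 \<le> r" "r \<le> 1" "0 \<le> z" for r z :: real
    using that assms powr_mono'[of 1 p r] by (simp add: powr_mult mult_right_mono)
  show "((1 - t) *\<^sub>R x + t *\<^sub>R y) powr p \<le> (1 - t) * x powr p + t * y powr p"
  proof (cases "x = 0 \<or> y = 0")
    case True
    then show ?thesis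
      using shrink[of t y] shrink[of "1 - t" x] t_bounds xy_nonneg by auto
  next
    case False
    then show ?thesis
      using convex_onD[OF powr_convex[OF assms], of t x y] t_bounds xy_nonneg by auto
  qed
qed simp

lemma
  assumes finite_nonempty: "finite J" "J \<noteq> {}" and weights: "\<And>j. j \<in> J \<Longrightarrow> a j \<ge> 0" "(\<Sum>j\<in>J. a j) = 1"
    and s_ge_1: "s \<ge> 1"
  shows L2_set_convex_sum_powr_le:
      "L2_set (\<lambda>i. \<Sum>j\<in>J. a j * f j i) A powr s \<le> (\<Sum>j\<in>J. a j * L2_set (f j) A powr s)"
    and L2_set_convex_sum_powr_less:
      "\<lbrakk>finite A; r \<in> A; j \<in> J; k \<in> J; a j > 0; a k > 0; f j r > 0; f k r < 0\<rbrakk>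
        \<Longrightarrow> L2_set (\<lambda>i. \<Sum>j\<in>J. a j * f j i) A powr s < (\<Sum>j\<in>J. a j * L2_set (f j) A powr s)"
proof -
  have norm_eq: "(\<Sum>j\<in>J. L2_set (\<lambda>i. a j * f j i) A) = (\<Sum>j\<in>J. a j * L2_set (f j) A)"
    using weights by (simp add: L2_set_cmult)
  have jensen: "(\<Sum>j\<in>J. a j * L2_set (f j) A) powr s \<le> (\<Sum>j\<in>J. a j * L2_set (f j) A powr s)"
    using convex_on_sum[OF finite_nonempty convex_on_powr_atLeast[OF s_ge_1] weights(2,1),
        of "\<lambda>j. L2_set (f j) A"] by simp
  have "L2_set (\<lambda>i. \<Sum>j\<in>J. a j * f j i) A powr s \<le> (\<Sum>j\<in>J. a j * L2_set (f j) A) powr s"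
    unfolding norm_eq[symmetric] using s_ge_1 by (intro powr_mono2 L2_set_sum_le) auto
  then show "L2_set (\<lambda>i. \<Sum>j\<in>J. a j * f j i) A powr s \<le> (\<Sum>j\<in>J. a j * L2_set (f j) A powr s)"
    using jensen by linarith
  assume "finite A" "r \<in> A" "j \<in> J" "k \<in> J" "a j > 0" "a k > 0" "f j r > 0" "f k r < 0"
  then have "L2_set (\<lambda>i. \<Sum>j\<in>J. a j * f j i) A powr s < (\<Sum>j\<in>J. a j * L2_set (f j) A) powr s"
    unfolding norm_eq[symmetric] using s_ge_1 finite_nonempty
    by (intro powr_less_mono2 L2_set_sum_less[of A r J j k]) (auto intro: mult_pos_neg)
  then show "L2_set (\<lambda>i. \<Sum>j\<in>J. a j * f j i) A powr s < (\<Sum>j\<in>J. a j * L2_set (f j) A powr s)"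
    using jensen by linarith
qed

section \<open>Spectral norm and largest eigenvalue\<close>

lemma vnorm_nonneg [simp]: "vnorm x \<ge> 0"
  by (simp add: vnorm_def scalar_prod_def sum_nonneg)

lemma vnorm_power2: "(vnorm x)\<^sup>2 = x \<bullet> x"
  by (simp add: vnorm_def scalar_prod_def sum_nonneg)

lemma vnorm_eq_L2_set: "x \<in> carrier_vec d \<Longrightarrow> vnorm x = L2_set (\<lambda>i. x $ i) {..<d}"
  by (auto simp: vnorm_def L2_set_def scalar_prod_def power2_eq_square lessThan_atLeast0)

lemma vnorm_vec: "vnorm (vec d u) = L2_set u {..<d}"
  by (simp add: vnorm_eq_L2_set[of _ d] cong: L2_set_cong_simp)

lemma vnorm_unit_vec: "j < d \<Longrightarrow> vnorm (unit_vec d j) = 1"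
  by (simp add: vnorm_def)

lemma vnorm_smult: "vnorm (t \<cdot>\<^sub>v x) = \<bar>t\<bar> * vnorm x"
proof -
  have "(t \<cdot>\<^sub>v x) \<bullet> (t \<cdot>\<^sub>v x) = t\<^sup>2 * (x \<bullet> x)"
    by (simp add: power2_eq_square)
  then show ?thesis
    by (simp add: vnorm_def real_sqrt_mult)
qed

lemma vnorm_eq_0_iff:
  assumes "x \<in> carrier_vec d"
  shows "vnorm x = 0 \<longleftrightarrow> x = 0\<^sub>v d"
  using assms by (auto simp: vnorm_eq_L2_set L2_set_eq_0_iff)

lemma vec_index_eq: "x \<in> carrier_vec d \<Longrightarrow> vec d (($) x) = x"
  by auto

lemma mult_mat_unit_vec:
  fixes A :: "'a::semiring_1 mat"
  shows "A \<in> carrier_mat n d \<Longrightarrow> j < d \<Longrightarrow> A *\<^sub>v unit_vec d j = col A j"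
  by (intro eq_vecI) auto

lemma vnorm_mult_mat_vec:
  assumes "A \<in> carrier_mat n d"
  shows "vnorm (A *\<^sub>v vec d u) = L2_set (\<lambda>p. \<Sum>q<d. u q * A $$ (p, q)) {..<n}"
  using assms by (subst vnorm_eq_L2_set[of _ n])
    (auto simp: scalar_prod_def lessThan_atLeast0 mult.commute intro!: L2_set_cong sum.cong)

lemma vnorm_mult_mat_vec_le:
  assumes A_carrier: "A \<in> carrier_mat n d" and x_carrier: "x \<in> carrier_vec d"
  shows "vnorm (A *\<^sub>v x) \<le> (\<Sum>j<d. vnorm (col A j)) * vnorm x"
proof -
  have vnorm_col: "vnorm (col A j) = L2_set (\<lambda>p. A $$ (p, j)) {..<n}" if "j < d" for j
    using A_carrier that by (subst vnorm_eq_L2_set[of _ n]) (auto intro!: L2_set_cong)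
  have "vnorm (A *\<^sub>v x) = L2_set (\<lambda>p. \<Sum>q<d. x $ q * A $$ (p, q)) {..<n}"
    using vnorm_mult_mat_vec[OF A_carrier, of "($) x"] by (simp add: vec_index_eq[OF x_carrier])
  also have "\<dots> \<le> (\<Sum>q<d. \<bar>x $ q\<bar> * vnorm (col A q))"
    by (rule order_trans[OF L2_set_sum_le]) (simp add: L2_set_cmult vnorm_col)
  also have "\<dots> \<le> (\<Sum>q<d. vnorm x * vnorm (col A q))"
    using x_carrier
    by (intro sum_mono mult_right_mono) (simp_all add: vnorm_eq_L2_set abs_le_L2_set)
  finally show ?thesis
    by (simp add: sum_distrib_left mult.commute)
qed

lemma continuous_on_vnorm_mult_mat_vec:
  assumes "A \<in> carrier_mat n d"
  shows "continuous_on UNIV (\<lambda>u. vnorm (A *\<^sub>v vec d u))"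
  unfolding vnorm_mult_mat_vec[OF assms] L2_set_def
  by (intro continuous_intros continuous_on_product_coordinates)

lemma compact_cube_L2_sphere: "compact {u :: 'i \<Rightarrow> real. (\<forall>i. \<bar>u i\<bar> \<le> 1) \<and> L2_set u A = 1}"
proof -
  have "compactin (product_topology (\<lambda>_. euclidean) UNIV) (\<Pi>\<^sub>E i\<in>UNIV. {-1..1 :: real})"
    by (simp add: compactin_PiE)
  then have "compact (\<Pi>\<^sub>E (i :: 'i)\<in>UNIV. {-1..1 :: real})"
    by (simp add: euclidean_product_topology)
  moreover have "closed {u :: 'i \<Rightarrow> real. L2_set u A = 1}"
    unfolding L2_set_def
    by (intro closed_Collect_eq continuous_intros continuous_on_product_coordinates)
  ultimately have "compact ((\<Pi>\<^sub>E i\<in>UNIV. {-1..1}) \<inter> {u :: 'i \<Rightarrow> real. L2_set u A = 1})"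
    by (rule compact_Int_closed)
  also have "(\<Pi>\<^sub>E i\<in>UNIV. {-1..1}) \<inter> {u :: 'i \<Rightarrow> real. L2_set u A = 1}
      = {u. (\<forall>i. \<bar>u i\<bar> \<le> 1) \<and> L2_set u A = 1}"
    by (auto simp: PiE_iff abs_le_iff minus_le_iff)
  finally show ?thesis .
qed

lemma spec_norm_attained:
  assumes A_carrier: "A \<in> carrier_mat d d" and d_pos: "d \<ge> 1"
  obtains x where "x \<in> carrier_vec d" "vnorm x = 1" "vnorm (A *\<^sub>v x) = spec_norm d A"
    "\<And>y. y \<in> carrier_vec d \<Longrightarrow> vnorm y = 1 \<Longrightarrow> vnorm (A *\<^sub>v y) \<le> spec_norm d A"
proof -
  define K where "K = {u :: nat \<Rightarrow> real. (\<forall>i. \<bar>u i\<bar> \<le> 1) \<and> L2_set u {..<d} = 1}"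
  have "indicator {0} \<in> K"
    using d_pos by (simp add: K_def L2_set_indicator_singleton)
  then have "K \<noteq> {}" by blast
  moreover have "compact K"
    unfolding K_def by (rule compact_cube_L2_sphere)
  moreover have "continuous_on K (\<lambda>u. vnorm (A *\<^sub>v vec d u))"
    using continuous_on_vnorm_mult_mat_vec[OF A_carrier] by (rule continuous_on_subset) simp
  ultimately have "\<exists>u\<in>K. \<forall>u'\<in>K. vnorm (A *\<^sub>v vec d u') \<le> vnorm (A *\<^sub>v vec d u)"
    by (intro continuous_attains_sup)
  then obtain u where u_maximal: "u \<in> K"
      "\<And>u'. u' \<in> K \<Longrightarrow> vnorm (A *\<^sub>v vec d u') \<le> vnorm (A *\<^sub>v vec d u)"
    by blast
  have unit_vec_le: "vnorm (A *\<^sub>v y) \<le> vnorm (A *\<^sub>v vec d u)"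
    if y_unit: "y \<in> carrier_vec d" "vnorm y = 1" for y
  proof -
    define u' where "u' i = (if i < d then y $ i else 0)" for i
    have y_eq: "vec d u' = y"
      using y_unit(1) by (auto simp: u'_def)
    have "\<bar>u' i\<bar> \<le> vnorm y" for i
      using abs_le_L2_set[of "{..<d}" i "\<lambda>i. y $ i"] y_unit(1) by (simp add: u'_def vnorm_eq_L2_set)
    then have "u' \<in> K"
      using y_unit(2) by (simp add: K_def y_eq flip: vnorm_vec)
    then show ?thesis
      using u_maximal(2)[of u'] by (simp add: y_eq)
  qed
  have "vnorm (vec d u) = 1"
    using u_maximal(1) by (simp add: K_def vnorm_vec)
  moreover from this have "spec_norm d A = vnorm (A *\<^sub>v vec d u)"
    unfolding spec_norm_def by (intro cSup_eq_maximum) (use unit_vec_le in auto)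
  ultimately show thesis
    using unit_vec_le by (intro that[of "vec d u"]) auto
qed

lemma spec_norm_nonneg:
  assumes "A \<in> carrier_mat d d" "d \<ge> 1"
  shows "spec_norm d A \<ge> 0"
proof -
  obtain x where "vnorm (A *\<^sub>v x) = spec_norm d A"
    by (rule spec_norm_attained[OF assms])
  then show ?thesis
    using vnorm_nonneg[of "A *\<^sub>v x"] by simp
qed

lemma vnorm_mult_mat_vec_le_spec_norm:
  assumes A_carrier: "A \<in> carrier_mat d d" and d_pos: "d \<ge> 1" and x_carrier: "x \<in> carrier_vec d"
  shows "vnorm (A *\<^sub>v x) \<le> spec_norm d A * vnorm x"
proof (cases "vnorm x = 0")
  case True
  then show ?thesis using vnorm_mult_mat_vec_le[OF A_carrier x_carrier] by simp
next
  case False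
  then have "vnorm x > 0"
    using vnorm_nonneg[of x] by linarith
  let ?y = "(1 / vnorm x) \<cdot>\<^sub>v x"
  have "?y \<in> carrier_vec d" "vnorm ?y = 1"
    using x_carrier False by (simp_all add: vnorm_smult)
  then have "vnorm (A *\<^sub>v ?y) \<le> spec_norm d A"
    by - (rule spec_norm_attained[OF A_carrier d_pos])
  then show ?thesis
    using A_carrier x_carrier \<open>vnorm x > 0\<close> by (simp add: mult_mat_vec vnorm_smult pos_divide_le_eq)
qed

lemma spec_norm_le:
  assumes A_carrier: "A \<in> carrier_mat d d" and d_pos: "d \<ge> 1"
    and unit_vec_le: "\<And>x. x \<in> carrier_vec d \<Longrightarrow> vnorm x = 1 \<Longrightarrow> vnorm (A *\<^sub>v x) \<le> c"
  shows "spec_norm d A \<le> c"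
proof -
  obtain x where "x \<in> carrier_vec d" "vnorm x = 1" "vnorm (A *\<^sub>v x) = spec_norm d A"
    by (rule spec_norm_attained[OF A_carrier d_pos])
  then show ?thesis
    using unit_vec_le[of x] by simp
qed

lemma vnorm_col_le_spec_norm:
  assumes A_carrier: "A \<in> carrier_mat d d" and "j < d"
  shows "vnorm (col A j) \<le> spec_norm d A"
  using vnorm_mult_mat_vec_le_spec_norm[OF A_carrier, of "unit_vec d j"] assms
  by (simp add: mult_mat_unit_vec[OF A_carrier] vnorm_unit_vec)

lemma spec_norm_le_sum_col:
  assumes A_carrier: "A \<in> carrier_mat d d" and d_pos: "d \<ge> 1"
  shows "spec_norm d A \<le> (\<Sum>j<d. vnorm (col A j))"
  using vnorm_mult_mat_vec_le[OF A_carrier] by (intro spec_norm_le[OF A_carrier d_pos]) force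

lemma scalar_prod_gram_mat:
  fixes A :: "real mat"
  assumes A_carrier: "A \<in> carrier_mat n d" and x_carrier: "x \<in> carrier_vec d"
    and y_carrier: "y \<in> carrier_vec d"
  shows "((transpose_mat A * A) *\<^sub>v x) \<bullet> y = (A *\<^sub>v x) \<bullet> (A *\<^sub>v y)"
  using transpose_vec_mult_scalar[OF A_carrier y_carrier, of "A *\<^sub>v x"] A_carrier x_carrier
  by (simp add: assoc_mult_mat_vec[of "transpose_mat A" d n A d x])

lemma scalar_prod_add_smult_self:
  fixes x z :: "real vec"
  assumes "x \<in> carrier_vec n" "z \<in> carrier_vec n"
  shows "(x + t \<cdot>\<^sub>v z) \<bullet> (x + t \<cdot>\<^sub>v z) = x \<bullet> x + 2 * t * (x \<bullet> z) + t\<^sup>2 * (z \<bullet> z)"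
  using assms comm_scalar_prod[of z n x]
  by (simp add: add_scalar_prod_distrib[of _ n] scalar_prod_add_distrib[of _ n]
      power2_eq_square algebra_simps)

lemma scalar_prod_le_vnorm:
  assumes "x \<in> carrier_vec n" "y \<in> carrier_vec n"
  shows "x \<bullet> y \<le> vnorm x * vnorm y"
proof -
  have "x \<bullet> y \<le> (\<Sum>i<n. \<bar>x $ i\<bar> * \<bar>y $ i\<bar>)"
    using assms
    by (auto simp: scalar_prod_def lessThan_atLeast0 simp flip: abs_mult intro!: sum_mono)
  also have "\<dots> \<le> vnorm x * vnorm y"
    using assms by (simp add: vnorm_eq_L2_set L2_set_mult_ineq)
  finally show ?thesis .
qed

text \<open>With \<open>S = A\<^sup>T A\<close> and \<open>\<sigma> = |A|\<close>, a maximiser \<open>x\<close> of \<open>|A x|\<close> on the unit sphere satisfies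
  \<open>S x \<bullet> x = \<sigma>\<^sup>2\<close> and \<open>|S x| \<le> \<sigma>\<^sup>2\<close>, which forces \<open>S x = \<sigma>\<^sup>2 x\<close>.\<close>

lemma eigenvalue_gram_mat_spec_norm:
  assumes A_carrier: "A \<in> carrier_mat d d" and d_pos: "d \<ge> 1"
  shows "eigenvalue (transpose_mat A * A) ((spec_norm d A)\<^sup>2)"
proof -
  define \<sigma> where "\<sigma> = spec_norm d A"
  define S where "S = transpose_mat A * A"
  obtain x where x_maximiser: "x \<in> carrier_vec d" "vnorm x = 1" "vnorm (A *\<^sub>v x) = \<sigma>"
    unfolding \<sigma>_def by (rule spec_norm_attained[OF A_carrier d_pos])
  define y where "y = S *\<^sub>v x"
  have S_carrier: "S \<in> carrier_mat d d" and y_carrier: "y \<in> carrier_vec d"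
    using A_carrier x_maximiser by (simp_all add: S_def y_def)
  have "(vnorm y)\<^sup>2 = (A *\<^sub>v x) \<bullet> (A *\<^sub>v y)"
    using scalar_prod_gram_mat[OF A_carrier x_maximiser(1) y_carrier]
    by (simp add: vnorm_power2 y_def S_def)
  also have "\<dots> \<le> \<sigma> * vnorm (A *\<^sub>v y)"
    using scalar_prod_le_vnorm[of "A *\<^sub>v x" d "A *\<^sub>v y"] A_carrier x_maximiser y_carrier by simp
  also have "\<dots> \<le> \<sigma> * (\<sigma> * vnorm y)"
    using vnorm_mult_mat_vec_le_spec_norm[OF A_carrier d_pos y_carrier] spec_norm_nonneg[OF A_carrier d_pos]
    by (intro mult_left_mono) (simp_all add: \<sigma>_def)
  finally have "vnorm y * vnorm y \<le> \<sigma>\<^sup>2 * vnorm y"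
    by (simp add: power2_eq_square mult.assoc)
  then have "vnorm y \<le> \<sigma>\<^sup>2"
    using vnorm_nonneg[of y] by (cases "vnorm y = 0") (auto simp: mult_le_cancel_right)
  then have "(vnorm y)\<^sup>2 \<le> (\<sigma>\<^sup>2)\<^sup>2"
    by (intro power_mono) auto
  moreover have "y \<bullet> x = \<sigma>\<^sup>2"
    using scalar_prod_gram_mat[OF A_carrier x_maximiser(1) x_maximiser(1)] x_maximiser(3)
    by (simp add: y_def S_def flip: vnorm_power2)
  ultimately have "(vnorm (y + (- \<sigma>\<^sup>2) \<cdot>\<^sub>v x))\<^sup>2 \<le> 0"
    using x_maximiser(2)
    by (simp add: vnorm_power2[of "_ + _"] scalar_prod_add_smult_self[OF y_carrier x_maximiser(1)])
      (simp add: power2_eq_square power4_eq_xxxx mult.assoc flip: vnorm_power2)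
  then have "y + (- \<sigma>\<^sup>2) \<cdot>\<^sub>v x = 0\<^sub>v d"
    using vnorm_eq_0_iff[of "y + (- \<sigma>\<^sup>2) \<cdot>\<^sub>v x" d] x_maximiser y_carrier by simp
  then have "S *\<^sub>v x = \<sigma>\<^sup>2 \<cdot>\<^sub>v x"
    using x_maximiser(1) y_carrier by (auto simp: vec_eq_iff y_def[symmetric])
  moreover have "x \<noteq> 0\<^sub>v d"
    using x_maximiser vnorm_eq_0_iff[OF x_maximiser(1)] by auto
  ultimately show ?thesis
    using S_carrier x_maximiser(1) unfolding eigenvalue_def eigenvector_def S_def \<sigma>_def
    by (intro exI[of _ x]) auto
qed

lemma lambda_max_gram_mat:
  assumes A_carrier: "A \<in> carrier_mat d d" and d_pos: "d \<ge> 1"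
  shows "lambda_max (transpose_mat A * A) = (spec_norm d A)\<^sup>2"
  unfolding lambda_max_def
proof (rule Max_eqI)
  let ?S = "transpose_mat A * A"
  have S_carrier: "?S \<in> carrier_mat d d" using A_carrier by simp
  have "char_poly ?S \<noteq> 0"
    using degree_monic_char_poly[OF S_carrier] d_pos by auto
  then show "finite {l. eigenvalue ?S l}"
    using poly_roots_finite[of "char_poly ?S"]
    by (simp add: eigenvalue_root_char_poly[OF S_carrier])
  show "(spec_norm d A)\<^sup>2 \<in> {l. eigenvalue ?S l}"
    using eigenvalue_gram_mat_spec_norm[OF assms] by simp
  fix l assume "l \<in> {l. eigenvalue ?S l}"
  then obtain x where x_eigenvector: "x \<in> carrier_vec d" "x \<noteq> 0\<^sub>v d" "?S *\<^sub>v x = l \<cdot>\<^sub>v x"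
    using S_carrier by (auto simp: eigenvalue_def eigenvector_def)
  have "l * (vnorm x)\<^sup>2 = (vnorm (A *\<^sub>v x))\<^sup>2"
    using scalar_prod_gram_mat[OF A_carrier x_eigenvector(1) x_eigenvector(1)] x_eigenvector
    by (simp add: vnorm_power2)
  also have "\<dots> \<le> (spec_norm d A * vnorm x)\<^sup>2"
    by (intro power_mono vnorm_mult_mat_vec_le_spec_norm[OF A_carrier d_pos x_eigenvector(1)]) simp
  finally have "l * (vnorm x)\<^sup>2 \<le> (spec_norm d A)\<^sup>2 * (vnorm x)\<^sup>2"
    by (simp add: power_mult_distrib)
  moreover have "(vnorm x)\<^sup>2 > 0"
    using vnorm_eq_0_iff[OF x_eigenvector(1)] x_eigenvector(2) by simp
  ultimately show "l \<le> (spec_norm d A)\<^sup>2"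
    by (rule mult_right_le_imp_le)
qed

lemma spec_norm_le_iff_dense:
  fixes D :: "(nat \<Rightarrow> real) set"
  assumes A_carrier: "A \<in> carrier_mat d d" and d_pos: "d \<ge> 1" and c_nonneg: "c \<ge> 0"
    and dense: "\<And>U. open U \<Longrightarrow> U \<noteq> {} \<Longrightarrow> \<exists>u\<in>D. u \<in> U"
  shows "spec_norm d A \<le> c \<longleftrightarrow> (\<forall>u\<in>D. vnorm (A *\<^sub>v vec d u) \<le> c * vnorm (vec d u))"
proof (intro iffI ballI)
  fix u assume "spec_norm d A \<le> c"
  then show "vnorm (A *\<^sub>v vec d u) \<le> c * vnorm (vec d u)"
    by (intro order_trans[OF vnorm_mult_mat_vec_le_spec_norm[OF A_carrier d_pos]] mult_right_mono) auto
next
  assume le_on_D: "\<forall>u\<in>D. vnorm (A *\<^sub>v vec d u) \<le> c * vnorm (vec d u)"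
  have "continuous_on UNIV (\<lambda>u. vnorm (vec d u))"
    using continuous_on_vnorm_mult_mat_vec[of "1\<^sub>m d" d d] by simp
  then have "open {u. c * vnorm (vec d u) < vnorm (A *\<^sub>v vec d u)}"
    by (intro open_Collect_less continuous_on_mult_left continuous_on_vnorm_mult_mat_vec[OF A_carrier])
  then have "{u. c * vnorm (vec d u) < vnorm (A *\<^sub>v vec d u)} = {}"
    using dense le_on_D by fastforce
  then have "vnorm (A *\<^sub>v vec d u) \<le> c * vnorm (vec d u)" for u
    by (auto simp: not_less)
  then have "vnorm (A *\<^sub>v x) \<le> c * vnorm x" if "x \<in> carrier_vec d" for x
    using vec_index_eq[OF that] by metis
  then show "spec_norm d A \<le> c"
    by (intro spec_norm_le[OF A_carrier d_pos]) fastforce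
qed

lemma borel_measurable_spec_norm:
  assumes A_carrier: "\<And>w. A w \<in> carrier_mat d d" and d_pos: "d \<ge> 1"
    and measurable_images [measurable]: "\<And>u. (\<lambda>w. vnorm (A w *\<^sub>v vec d u)) \<in> borel_measurable M"
  shows "(\<lambda>w. spec_norm d (A w)) \<in> borel_measurable M"
  unfolding borel_measurable_iff_le
proof
  fix c :: real
  obtain D :: "(nat \<Rightarrow> real) set"
    where D_dense: "countable D" "\<And>U. open U \<Longrightarrow> U \<noteq> {} \<Longrightarrow> \<exists>u\<in>D. u \<in> U"
    by (rule countable_dense_setE) (rule that)
  show "{w \<in> space M. spec_norm d (A w) \<le> c} \<in> sets M"
  proof (cases "c \<ge> 0")
    case True
    have "{w \<in> space M. spec_norm d (A w) \<le> c}
        = {w \<in> space M. \<forall>u\<in>D. vnorm (A w *\<^sub>v vec d u) \<le> c * vnorm (vec d u)}"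
      using spec_norm_le_iff_dense[OF A_carrier d_pos True D_dense(2)] by simp
    also have "\<dots> \<in> sets M"
      using D_dense(1) by measurable
    finally show ?thesis .
  next
    case False
    then have "\<not> spec_norm d (A w) \<le> c" for w
      using spec_norm_nonneg[OF A_carrier d_pos, of w] by linarith
    then show ?thesis by simp
  qed
qed

section \<open>The linear part of stochastic gradient descent\<close>

definition sgd_step :: "real \<Rightarrow> nat set \<Rightarrow> nat \<Rightarrow> (nat \<times> nat \<Rightarrow> real) \<Rightarrow> (nat \<Rightarrow> real) \<Rightarrow> nat \<Rightarrow> real" where
  "sgd_step \<kappa> I d w u = (\<lambda>p. u p - \<kappa> * (\<Sum>i\<in>I. w (i, p) * (\<Sum>q<d. w (i, q) * u q)))"

fun sgd_iterate :: "real \<Rightarrow> nat \<Rightarrow> nat \<Rightarrow> (nat \<times> nat \<Rightarrow> real) \<Rightarrow> nat \<Rightarrow> (nat \<Rightarrow> real) \<Rightarrow> nat \<Rightarrow> real" where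
  "sgd_iterate \<kappa> b d w 0 u = u"
| "sgd_iterate \<kappa> b d w (Suc k) u
    = sgd_step \<kappa> {b * k + 1 .. b * Suc k} d w (sgd_iterate \<kappa> b d w k u)"

lemma sgd_step_cong:
  assumes "\<And>r. r < d \<Longrightarrow> u r = u' r" "r < d" "\<And>i r. i \<in> I \<Longrightarrow> r < d \<Longrightarrow> w (i, r) = w' (i, r)"
  shows "sgd_step \<kappa> I d w u r = sgd_step \<kappa> I d w' u' r"
  using assms by (simp add: sgd_step_def)

lemma sgd_step_cmult: "sgd_step \<kappa> I d w (\<lambda>r. c * u r) = (\<lambda>r. c * sgd_step \<kappa> I d w u r)"
  by (rule ext) (simp add: sgd_step_def algebra_simps sum_distrib_left)

lemma sgd_iterate_cong:
  assumes "r < d" "\<And>i r. i \<le> b * k \<Longrightarrow> r < d \<Longrightarrow> w (i, r) = w' (i, r)"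
  shows "sgd_iterate \<kappa> b d w k u r = sgd_iterate \<kappa> b d w' k u r"
  using assms
proof (induction k arbitrary: r)
  case (Suc k)
  have "b * k \<le> b * Suc k" by simp
  then show ?case
    using Suc.prems unfolding sgd_iterate.simps
    by (intro sgd_step_cong Suc.IH) (auto intro: order_trans)
qed simp

lemma measurable_L2_set [measurable (raw)]:
  assumes "\<And>i. i \<in> A \<Longrightarrow> (\<lambda>x. f x i) \<in> borel_measurable M"
  shows "(\<lambda>x. L2_set (f x) A) \<in> borel_measurable M"
  unfolding L2_set_def using assms by measurable

lemma measurable_sgd_step [measurable (raw)]:
  assumes [measurable]: "\<And>p. (\<lambda>x. w x p) \<in> borel_measurable M"
      "\<And>r. (\<lambda>x. u x r) \<in> borel_measurable M"
  shows "(\<lambda>x. sgd_step \<kappa> I d (w x) (u x) r) \<in> borel_measurable M"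
  unfolding sgd_step_def by measurable

lemma measurable_sgd_iterate [measurable (raw)]:
  assumes "\<And>p. (\<lambda>x. w x p) \<in> borel_measurable M"
  shows "(\<lambda>x. sgd_iterate \<kappa> b d (w x) k u r) \<in> borel_measurable M"
proof (induction k arbitrary: r)
  case (Suc k)
  then show ?case
    unfolding sgd_iterate.simps by (intro measurable_sgd_step assms)
qed simp

lemma Mmat_carrier [simp]: "Mmat \<eta> b d w k \<in> carrier_mat d d"
  by (auto simp: Mmat_def Hmat_def)

lemma Pimat_carrier [simp]: "Pimat \<eta> b d w k \<in> carrier_mat d d"
  by (induction k) (simp_all add: mult_carrier_mat[OF Mmat_carrier])

lemma Mmat_mult_vec:
  "Mmat \<eta> b d w (Suc k) *\<^sub>v vec d u = vec d (sgd_step (\<eta> / real b) {b * k + 1 .. b * Suc k} d w u)"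
proof (rule eq_vecI)
  let ?I = "{b * k + 1 .. b * Suc k}" and ?\<kappa> = "\<eta> / real b"
  fix p assume "p < dim_vec (vec d (sgd_step ?\<kappa> ?I d w u))"
  then have p_less: "p < d" by simp
  have "(Mmat \<eta> b d w (Suc k) *\<^sub>v vec d u) $ p
      = (\<Sum>q<d. (of_bool (p = q) - ?\<kappa> * (\<Sum>i\<in>?I. w (i, p) * w (i, q))) * u q)"
    using p_less
    by (auto simp: Mmat_def Hmat_def avec_def scalar_prod_def lessThan_atLeast0 intro!: sum.cong)
  also have "\<dots> = (\<Sum>q<d. of_bool (p = q) * u q) - ?\<kappa> * (\<Sum>q<d. \<Sum>i\<in>?I. w (i, p) * (w (i, q) * u q))"
    by (simp add: left_diff_distrib sum_subtractf sum_distrib_left sum_distrib_right mult.assoc)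
  also have "(\<Sum>q<d. of_bool (p = q) * u q) = u p"
    using p_less by (simp add: of_bool_def if_distrib[where f="\<lambda>x. x * _"] cong: if_cong)
  also have "(\<Sum>q<d. \<Sum>i\<in>?I. w (i, p) * (w (i, q) * u q))
      = (\<Sum>i\<in>?I. w (i, p) * (\<Sum>q<d. w (i, q) * u q))"
    by (subst sum.swap) (simp add: sum_distrib_left)
  finally show "(Mmat \<eta> b d w (Suc k) *\<^sub>v vec d u) $ p = vec d (sgd_step ?\<kappa> ?I d w u) $ p"
    using p_less by (simp add: sgd_step_def)
qed (simp add: Mmat_def Hmat_def)

lemma Pimat_mult_vec: "Pimat \<eta> b d w k *\<^sub>v vec d u = vec d (sgd_iterate (\<eta> / real b) b d w k u)"
proof (induction k)
  case (Suc k)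
  have "Pimat \<eta> b d w (Suc k) *\<^sub>v vec d u = Mmat \<eta> b d w (Suc k) *\<^sub>v (Pimat \<eta> b d w k *\<^sub>v vec d u)"
    by (simp add: assoc_mult_mat_vec[OF Mmat_carrier Pimat_carrier])
  then show ?case
    by (simp only: Suc.IH Mmat_mult_vec sgd_iterate.simps)
qed simp

lemma vnorm_col_Pimat:
  assumes "j < d"
  shows "vnorm (col (Pimat \<eta> b d w k) j)
      = L2_set (sgd_iterate (\<eta> / real b) b d w k (indicator {j})) {..<d}"
proof -
  have "unit_vec d j = vec d (indicator {j} :: nat \<Rightarrow> real)"
    by (auto simp: unit_vec_def indicator_def)
  then show ?thesis
    by (simp only: mult_mat_unit_vec[OF Pimat_carrier assms, symmetric] Pimat_mult_vec vnorm_vec)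
qed

lemma measurable_spec_norm_Pimat [measurable (raw)]:
  assumes "d \<ge> 1" "\<And>p. (\<lambda>x. w x p) \<in> borel_measurable M"
  shows "(\<lambda>x. spec_norm d (Pimat \<eta> b d (w x) k)) \<in> borel_measurable M"
  using assms
  by (intro borel_measurable_spec_norm)
     (simp_all add: Pimat_mult_vec vnorm_vec measurable_L2_set measurable_sgd_iterate)

section \<open>Reduction to unit variance\<close>

lemma Hmat_cmult: "Hmat b d (\<lambda>i. c * w i) k = c\<^sup>2 \<cdot>\<^sub>m Hmat b d w k"
  by (rule eq_matI) (auto simp: Hmat_def avec_def sum_distrib_left power2_eq_square mult_ac)

lemma Mmat_cmult: "Mmat \<eta> b d (\<lambda>i. c * w i) k = Mmat (\<eta> * c\<^sup>2) b d w k"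
  unfolding Mmat_def Hmat_cmult by (rule eq_matI) (auto simp: Hmat_def)

lemma Pimat_cmult: "Pimat \<eta> b d (\<lambda>i. c * w i) k = Pimat (\<eta> * c\<^sup>2) b d w k"
  by (induction k) (simp_all add: Mmat_cmult)

lemma distr_normal_density_cmult:
  assumes "\<sigma> > 0" "c \<noteq> 0"
  shows "distr (density lborel (normal_density 0 \<sigma>)) lborel (\<lambda>x. c * x)
      = density lborel (normal_density 0 (\<bar>c\<bar> * \<sigma>))"
proof -
  interpret prob_space "density lborel (normal_density 0 \<sigma>)"
    by (rule prob_space_normal_density[OF assms(1)])
  have "distributed (density lborel (normal_density 0 \<sigma>)) lborel (\<lambda>x. x) (normal_density 0 \<sigma>)"
    by (simp add: distributed_def distr_id2)
  from normal_density_affine[OF this assms, of 0] show ?thesis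
    by (simp add: distributed_def)
qed

lemma distr_data_space_cmult:
  assumes "v > 0" "c \<noteq> 0"
  shows "distr (data_space v) (data_space (c\<^sup>2 * v)) (\<lambda>w i. c * w i) = data_space (c\<^sup>2 * v)"
proof -
  let ?N = "\<lambda>v. density lborel (normal_density 0 (sqrt v))"
  have "distr (?N v) (?N (c\<^sup>2 * v)) (\<lambda>x. c * x) = ?N (c\<^sup>2 * v)"
    using distr_normal_density_cmult[of "sqrt v" c] assms
    by (simp add: real_sqrt_mult cong: distr_cong)
  moreover have "prob_space (?N v)"
    using assms by (intro prob_space_normal_density) simp
  ultimately show ?thesis
    using distr_PiM_map[of "\<lambda>_. ?N v" "\<lambda>_ x. c * x" "\<lambda>_. ?N (c\<^sup>2 * v)"] by (simp add: data_space_def)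
qed

lemma measurable_data_space_cmult: "(\<lambda>w i. c * w i) \<in> data_space v \<rightarrow>\<^sub>M data_space v'"
  unfolding data_space_def by (rule measurable_PiM_single') (auto simp: space_PiM)

lemma AE_data_space_cmult:
  assumes "v > 0" "c \<noteq> 0"
  shows "(AE w in data_space (c\<^sup>2 * v). Q w) \<longleftrightarrow> (AE w in data_space v. Q (\<lambda>i. c * w i))"
proof
  assume "AE w in data_space (c\<^sup>2 * v). Q w"
  then have "AE w in distr (data_space v) (data_space (c\<^sup>2 * v)) (\<lambda>w i. c * w i). Q w"
    by (simp only: distr_data_space_cmult[OF assms])
  then show "AE w in data_space v. Q (\<lambda>i. c * w i)"
    by (rule AE_distrD[OF measurable_data_space_cmult])
next
  assume AE_v: "AE w in data_space v. Q (\<lambda>i. c * w i)"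
  have "distr (data_space (c\<^sup>2 * v)) (data_space v) (\<lambda>w i. (1 / c) * w i) = data_space v"
    using distr_data_space_cmult[of "c\<^sup>2 * v" "1 / c"] assms by (simp add: power_divide)
  with AE_v have "AE w in distr (data_space (c\<^sup>2 * v)) (data_space v) (\<lambda>w i. (1 / c) * w i). Q (\<lambda>i. c * w i)"
    by (simp only:)
  then have "AE w in data_space (c\<^sup>2 * v). Q (\<lambda>i. c * ((1 / c) * w i))"
    by (rule AE_distrD[OF measurable_data_space_cmult])
  then show "AE w in data_space (c\<^sup>2 * v). Q w"
    using assms(2) by simp
qed

lemma rho_unit_variance:
  assumes "v > 0"
  shows "rho \<eta> v b d = rho (\<eta> * v) 1 b d"
proof -
  have v_eq: "(sqrt v)\<^sup>2 * 1 = v"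
    using assms by simp
  have "(AE w in data_space v. Q w) \<longleftrightarrow> (AE w in data_space 1. Q (\<lambda>i. sqrt v * w i))" for Q
    using AE_data_space_cmult[of 1 "sqrt v" Q] assms unfolding v_eq by simp
  then show ?thesis
    using assms by (simp add: rho_def Pimat_cmult)
qed

lemma hfun_unit_variance:
  assumes "v > 0" "d \<ge> 1"
  shows "hfun \<eta> v b d s = hfun (\<eta> * v) 1 b d s"
proof -
  have "(\<integral>w. spec_norm d (Pimat \<eta> b d w k) powr s \<partial>data_space v)
      = (\<integral>w. spec_norm d (Pimat (\<eta> * v) b d w k) powr s \<partial>data_space 1)" for k
  proof -
    have [measurable]: "(\<lambda>w. spec_norm d (Pimat \<eta> b d w k)) \<in> borel_measurable (data_space v)"
      unfolding data_space_def using assms by measurable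
    have "data_space v = distr (data_space 1) (data_space v) (\<lambda>w i. sqrt v * w i)"
      using distr_data_space_cmult[of 1 "sqrt v"] assms by simp
    then have "(\<integral>w. spec_norm d (Pimat \<eta> b d w k) powr s \<partial>data_space v)
        = (\<integral>w. spec_norm d (Pimat \<eta> b d w k) powr s \<partial>distr (data_space 1) (data_space v) (\<lambda>w i. sqrt v * w i))"
      by simp
    also have "\<dots> = (\<integral>w. spec_norm d (Pimat (\<eta> * v) b d w k) powr s \<partial>data_space 1)"
      using assms by (subst integral_distr) (simp_all add: measurable_data_space_cmult Pimat_cmult)
    finally show ?thesis .
  qed
  then show ?thesis by (simp add: hfun_def)
qed

lemma admissible_unit_variance:
  assumes "admissible \<eta> v b d"
  shows "admissible (\<eta> * v) 1 b d"
  using assms rho_unit_variance[of v \<eta> b d] by (simp add: admissible_def)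

lemma tail_index_unit_variance:
  assumes "admissible \<eta> v b d"
  shows "tail_index \<eta> v b d = tail_index (\<eta> * v) 1 b d"
  using assms by (simp add: admissible_def tail_index_def hfun_unit_variance[of v d \<eta>])

section \<open>Rotation invariance of the gradient step\<close>

lemma sum_givens_mult:
  assumes coordinates: "finite A" "p \<in> A" "q \<in> A" "p \<noteq> q" and circle: "c\<^sup>2 + s\<^sup>2 = 1"
  shows "(\<Sum>r\<in>A. givens c s p q u r * givens c s p q x r) = (\<Sum>r\<in>A. u r * x r)"
proof -
  have split: "(\<Sum>r\<in>A. f r) = f p + f q + (\<Sum>r\<in>A - {p} - {q}. f r)" for f :: "'a \<Rightarrow> real"
    using coordinates by (simp add: sum.remove[of A p] sum.remove[of "A - {p}" q])
  have "(\<Sum>r\<in>A - {p} - {q}. givens c s p q u r * givens c s p q x r) = (\<Sum>r\<in>A - {p} - {q}. u r * x r)"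
    by (intro sum.cong) (auto simp: givens_def)
  moreover have "(c * u p - s * u q) * (c * x p - s * x q) + (s * u p + c * u q) * (s * x p + c * x q)
      = (c\<^sup>2 + s\<^sup>2) * (u p * x p + u q * x q)"
    by (simp add: power2_eq_square algebra_simps)
  ultimately show ?thesis
    using coordinates circle by (simp add: split givens_def)
qed

lemma L2_set_givens:
  assumes "finite A" "p \<in> A" "q \<in> A" "p \<noteq> q" "c\<^sup>2 + s\<^sup>2 = 1"
  shows "L2_set (givens c s p q u) A = L2_set u A"
  using sum_givens_mult[OF assms, of u u] by (simp add: L2_set_def power2_eq_square)

definition rotate_rows :: "real \<Rightarrow> real \<Rightarrow> 'b \<Rightarrow> 'b \<Rightarrow> 'a set \<Rightarrow> ('a \<times> 'b \<Rightarrow> real) \<Rightarrow> 'a \<times> 'b \<Rightarrow> real" where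
  "rotate_rows c s p q I w = (\<lambda>(i, r). if i \<in> I then givens c s p q (\<lambda>r. w (i, r)) r else w (i, r))"

lemma rotate_rows_insert:
  assumes "i \<notin> I"
  shows "rotate_rows c s p q (insert i I) w = givens c s (i, p) (i, q) (rotate_rows c s p q I w)"
  using assms by (auto simp: rotate_rows_def givens_def fun_eq_iff)

lemma nn_integral_rotate_rows:
  assumes "finite I" and "f \<in> borel_measurable white_noise" and "p \<noteq> q" "c\<^sup>2 + s\<^sup>2 = 1"
  shows "(\<integral>\<^sup>+w. f (rotate_rows c s p q I w) \<partial>white_noise) = (\<integral>\<^sup>+w. f w \<partial>white_noise)"
  using assms(1,2)
proof (induction I arbitrary: f)
  case empty
  then show ?case by (simp add: rotate_rows_def)
next
  case (insert i I)
  note [measurable] = insert.prems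
  have "(\<integral>\<^sup>+w. f (rotate_rows c s p q (insert i I) w) \<partial>white_noise)
      = (\<integral>\<^sup>+w. f (givens c s (i, p) (i, q) (rotate_rows c s p q I w)) \<partial>white_noise)"
    by (simp only: rotate_rows_insert[OF insert.hyps(2)])
  also have "\<dots> = (\<integral>\<^sup>+w. f (givens c s (i, p) (i, q) w) \<partial>white_noise)"
    by (rule insert.IH) measurable
  also have "\<dots> = (\<integral>\<^sup>+w. f w \<partial>white_noise)"
    using assms(3,4) by (intro nn_integral_white_noise_givens insert.prems) auto
  finally show ?case .
qed

lemma sgd_step_rotate_rows:
  assumes coordinates: "p < d" "q < d" "p \<noteq> q" and circle: "c\<^sup>2 + s\<^sup>2 = 1"
  shows "sgd_step \<kappa> I d (rotate_rows c s p q I w) (givens c s p q u)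
      = givens c s p q (sgd_step \<kappa> I d w u)"
proof
  fix r
  let ?y = "\<lambda>i. \<Sum>r<d. w (i, r) * u r"
  have "(\<Sum>r<d. rotate_rows c s p q I w (i, r) * givens c s p q u r) = ?y i" if "i \<in> I" for i
    using sum_givens_mult[of "{..<d}" p q c s "\<lambda>r. w (i, r)" u] that coordinates circle
    by (simp add: rotate_rows_def)
  then have "sgd_step \<kappa> I d (rotate_rows c s p q I w) (givens c s p q u) r
      = givens c s p q u r - \<kappa> * (\<Sum>i\<in>I. givens c s p q (\<lambda>r. w (i, r)) r * ?y i)"
    unfolding sgd_step_def by (simp add: rotate_rows_def cong: sum.cong)
  also have "\<dots> = givens c s p q (sgd_step \<kappa> I d w u) r"
    by (simp add: givens_def sgd_step_def algebra_simps sum.distrib sum_subtractf sum_distrib_left)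
  finally show "sgd_step \<kappa> I d (rotate_rows c s p q I w) (givens c s p q u) r
      = givens c s p q (sgd_step \<kappa> I d w u) r" .
qed

lemma nn_integral_sgd_step_givens:
  assumes "finite I" and [measurable]: "f \<in> borel_measurable borel"
    and coordinates: "p < d" "q < d" "p \<noteq> q" and circle: "c\<^sup>2 + s\<^sup>2 = 1"
  shows "(\<integral>\<^sup>+w. f (L2_set (sgd_step \<kappa> I d w (givens c s p q u)) {..<d}) \<partial>white_noise)
    = (\<integral>\<^sup>+w. f (L2_set (sgd_step \<kappa> I d w u) {..<d}) \<partial>white_noise)"
proof -
  have "(\<integral>\<^sup>+w. f (L2_set (sgd_step \<kappa> I d w (givens c s p q u)) {..<d}) \<partial>white_noise)
      = (\<integral>\<^sup>+w. f (L2_set (sgd_step \<kappa> I d (rotate_rows c s p q I w) (givens c s p q u)) {..<d}) \<partial>white_noise)"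
    by (rule nn_integral_rotate_rows[OF assms(1) _ coordinates(3) circle, symmetric]) measurable
  also have "\<dots> = (\<integral>\<^sup>+w. f (L2_set (sgd_step \<kappa> I d w u) {..<d}) \<partial>white_noise)"
    using coordinates circle by (simp add: sgd_step_rotate_rows L2_set_givens)
  finally show ?thesis .
qed

text \<open>The first column of \<open>I - \<kappa> \<Sum> a\<^sub>i a\<^sub>i\<^sup>T\<close>, where the \<open>a\<^sub>i\<close> are the rows of \<open>w\<close>. Its entries
  do not depend on the dimension.\<close>

definition first_column :: "real \<Rightarrow> nat set \<Rightarrow> (nat \<times> nat \<Rightarrow> real) \<Rightarrow> nat \<Rightarrow> real" where
  "first_column \<kappa> I w p = indicator {0} p - \<kappa> * (\<Sum>i\<in>I. w (i, p) * w (i, 0))"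

definition gain :: "real \<Rightarrow> nat set \<Rightarrow> nat \<Rightarrow> (nat \<times> nat \<Rightarrow> real) \<Rightarrow> real" where
  "gain \<kappa> I d w = L2_set (first_column \<kappa> I w) {..<d}"

lemma sgd_step_indicator_0:
  assumes "d \<ge> 1"
  shows "sgd_step \<kappa> I d w (indicator {0}) = first_column \<kappa> I w"
proof -
  have "(\<Sum>q<d. w (i, q) * indicator {0} q) = w (i, 0)" for i
    using assms by (simp add: indicator_def if_distrib[where f="\<lambda>x. _ * x"] cong: if_cong)
  then show ?thesis
    by (simp add: sgd_step_def first_column_def fun_eq_iff)
qed

lemma gain_nonneg [simp]: "gain \<kappa> I d w \<ge> 0"
  by (simp add: gain_def)

lemma measurable_first_column [measurable (raw)]:
  assumes [measurable]: "\<And>p. (\<lambda>x. w x p) \<in> borel_measurable M"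
  shows "(\<lambda>x. first_column \<kappa> I (w x) p) \<in> borel_measurable M"
  unfolding first_column_def by measurable

lemma measurable_gain [measurable (raw)]:
  assumes [measurable]: "\<And>p. (\<lambda>x. w x p) \<in> borel_measurable M"
  shows "(\<lambda>x. gain \<kappa> I d (w x)) \<in> borel_measurable M"
  unfolding gain_def by measurable

lemma continuous_on_gain: "continuous_on UNIV (gain \<kappa> I d)"
  unfolding gain_def first_column_def L2_set_def
  by (intro continuous_intros continuous_on_product_coordinates)

lemma L2_set_sgd_step_axis:
  assumes d_pos: "d \<ge> 1" and u_vanishes: "\<And>r. 0 < r \<Longrightarrow> r < d \<Longrightarrow> u r = 0"
  shows "L2_set (sgd_step \<kappa> I d w u) {..<d} = L2_set u {..<d} * gain \<kappa> I d w"
proof -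
  have u_eq: "u r = u 0 * indicator {0} r" if "r < d" for r
    using u_vanishes that by (cases "r = 0") auto
  have "L2_set u {..<d} = L2_set (\<lambda>r. u 0 * indicator {0} r) {..<d}"
    by (intro L2_set_cong) (use u_eq in blast)+
  also have "\<dots> = \<bar>u 0\<bar>"
    using d_pos by (simp add: L2_set_cmult L2_set_indicator_singleton)
  finally have "L2_set u {..<d} = \<bar>u 0\<bar>" .
  moreover have "L2_set (sgd_step \<kappa> I d w u) {..<d}
      = L2_set (sgd_step \<kappa> I d w (\<lambda>r. u 0 * indicator {0} r)) {..<d}"
    by (intro L2_set_cong sgd_step_cong) (use u_eq in blast)+
  ultimately show ?thesis
    by (simp add: sgd_step_cmult L2_set_cmult sgd_step_indicator_0[OF d_pos] gain_def)
qed

text \<open>Givens rotations in the coordinates 0 and \<open>n\<close> move \<open>u\<close> onto the first axis without changing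
  the law of the norm of the step.\<close>

lemma nn_integral_sgd_step:
  assumes finite_I: "finite I" and d_pos: "d \<ge> 1"
    and f_measurable [measurable]: "f \<in> borel_measurable borel"
  shows "(\<integral>\<^sup>+w. f (L2_set (sgd_step \<kappa> I d w u) {..<d}) \<partial>white_noise)
    = (\<integral>\<^sup>+w. f (L2_set u {..<d} * gain \<kappa> I d w) \<partial>white_noise)"
proof -
  have "(\<integral>\<^sup>+w. f (L2_set (sgd_step \<kappa> I d w u) {..<d}) \<partial>white_noise)
      = (\<integral>\<^sup>+w. f (L2_set u {..<d} * gain \<kappa> I d w) \<partial>white_noise)"
    if "n \<ge> 1" "n \<le> d" "\<And>r. n \<le> r \<Longrightarrow> r < d \<Longrightarrow> u r = 0" for n and u :: "nat \<Rightarrow> real"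
    using that
  proof (induction n arbitrary: u rule: nat_induct_at_least)
    case base
    then show ?case
      by (simp add: L2_set_sgd_step_axis[OF d_pos])
  next
    case (Suc n)
    obtain c s where rotation: "c\<^sup>2 + s\<^sup>2 = 1" "s * u 0 + c * u n = 0"
      by (rule ex_rotation_annihilating)
    have coordinates: "0 < d" "n < d" "0 \<noteq> n"
      using Suc by auto
    have "givens c s 0 n u r = 0" if "n \<le> r" "r < d" for r
      using that coordinates Suc.prems(2)[of r] rotation(2) by (auto simp: givens_def)
    then have "(\<integral>\<^sup>+w. f (L2_set (sgd_step \<kappa> I d w (givens c s 0 n u)) {..<d}) \<partial>white_noise)
        = (\<integral>\<^sup>+w. f (L2_set (givens c s 0 n u) {..<d} * gain \<kappa> I d w) \<partial>white_noise)"
      using coordinates by (intro Suc.IH) auto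
    then show ?case
      using coordinates rotation(1)
      by (simp add: nn_integral_sgd_step_givens[OF finite_I f_measurable] L2_set_givens)
  qed
  from this[of d] show ?thesis
    using d_pos by simp
qed

lemma nn_integral_sgd_step_powr:
  assumes "finite I" "d \<ge> 1"
  shows "(\<integral>\<^sup>+w. ennreal (L2_set (sgd_step \<kappa> I d w u) {..<d} powr s) \<partial>white_noise)
    = ennreal (L2_set u {..<d} powr s) * (\<integral>\<^sup>+w. ennreal (gain \<kappa> I d w powr s) \<partial>white_noise)"
proof -
  have "(\<integral>\<^sup>+w. ennreal (L2_set (sgd_step \<kappa> I d w u) {..<d} powr s) \<partial>white_noise)
      = (\<integral>\<^sup>+w. ennreal ((L2_set u {..<d} * gain \<kappa> I d w) powr s) \<partial>white_noise)"
    by (rule nn_integral_sgd_step) (use assms in simp_all)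
  then show ?thesis
    by (simp add: powr_mult ennreal_mult' nn_integral_cmult)
qed

lemma nn_integral_gain_reindex:
  assumes [measurable]: "f \<in> borel_measurable borel" and inj_pi: "inj \<pi>"
  shows "(\<integral>\<^sup>+w. f (gain \<kappa> (\<pi> ` I) d w) \<partial>white_noise) = (\<integral>\<^sup>+w. f (gain \<kappa> I d w) \<partial>white_noise)"
proof -
  let ?\<pi> = "\<lambda>(i, r). (\<pi> i, r :: nat)"
  have "gain \<kappa> (\<pi> ` I) d w = gain \<kappa> I d (\<lambda>i. w (?\<pi> i))" for w
    using inj_pi by (simp add: gain_def first_column_def[abs_def] sum.reindex inj_on_subset)
  moreover have "inj ?\<pi>"
    using inj_pi by (auto simp: inj_on_def)
  ultimately show ?thesis
    using nn_integral_PiM_reindex[OF prob_space_std_normal, of ?\<pi> "\<lambda>w. f (gain \<kappa> I d w)"] by simp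
qed

lemma nn_integral_gain_card_cong:
  assumes [measurable]: "f \<in> borel_measurable borel"
    and same_card: "finite I" "finite I'" "card I = card I'"
  shows "(\<integral>\<^sup>+w. f (gain \<kappa> I d w) \<partial>white_noise) = (\<integral>\<^sup>+w. f (gain \<kappa> I' d w) \<partial>white_noise)"
proof -
  obtain h where h_bij: "bij_betw h I I'"
    using finite_same_card_bij[OF same_card] by blast
  obtain m where m_bound: "\<And>i. i \<in> I' \<Longrightarrow> i < m"
    using same_card(2) by (auto simp: finite_nat_set_iff_bounded)
  define \<pi> where "\<pi> i = (if i \<in> I then h i else m + i)" for i
  have h_less: "h i < m" if "i \<in> I" for i
    using h_bij m_bound that by (auto simp: bij_betw_def)
  have "inj \<pi>"
  proof (rule injI)
    fix i j assume "\<pi> i = \<pi> j"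
    then show "i = j"
      using h_less[of i] h_less[of j] inj_onD[OF bij_betw_imp_inj_on[OF h_bij], of i j]
      by (auto simp: \<pi>_def split: if_splits)
  qed
  moreover have "\<pi> ` I = I'"
    using h_bij by (simp add: \<pi>_def bij_betw_def)
  ultimately show ?thesis
    using nn_integral_gain_reindex[OF assms(1), of \<pi> \<kappa> I d] by simp
qed

text \<open>No lower bound on \<open>s\<close> is needed, since \<open>0 powr s = 0\<close> also for negative \<open>s\<close>.\<close>

lemma nn_integral_sgd_iterate_powr:
  assumes d_pos: "d \<ge> 1"
  shows "(\<integral>\<^sup>+w. ennreal (L2_set (sgd_iterate \<kappa> b d w k u) {..<d} powr s) \<partial>white_noise)
    = ennreal (L2_set u {..<d} powr s) * (\<integral>\<^sup>+w. ennreal (gain \<kappa> {1..b} d w powr s) \<partial>white_noise) ^ k"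
proof (induction k)
  case 0
  interpret prob_space "white_noise :: (nat \<times> nat \<Rightarrow> real) measure" by (rule prob_space_white_noise)
  show ?case
    using emeasure_space_1 by simp
next
  case (Suc k)
  define future where "future = {b * k<..} \<times> (UNIV :: nat set)"
  let ?I = "{b * k + 1 .. b * Suc k}"
  let ?m = "\<integral>\<^sup>+w. ennreal (gain \<kappa> {1..b} d w powr s) \<partial>white_noise"
  let ?x = "\<lambda>k w. sgd_iterate \<kappa> b d w k u"
  have batch: "(\<integral>\<^sup>+w. ennreal (gain \<kappa> ?I d w powr s) \<partial>white_noise) = ?m"
    by (rule nn_integral_gain_card_cong) simp_all
  have split: "L2_set (?x (Suc k) (override_on w w' future)) {..<d}
      = L2_set (sgd_step \<kappa> ?I d w' (?x k w)) {..<d}" for w w'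
    unfolding sgd_iterate.simps
    by (intro L2_set_cong sgd_step_cong sgd_iterate_cong) (auto simp: override_on_def future_def)
  have "(\<integral>\<^sup>+w. ennreal (L2_set (?x (Suc k) w) {..<d} powr s) \<partial>white_noise)
      = (\<integral>\<^sup>+w. \<integral>\<^sup>+w'. ennreal (L2_set (?x (Suc k) (override_on w w' future)) {..<d} powr s) \<partial>white_noise \<partial>white_noise)"
    by (rule nn_integral_PiM_override_on[OF prob_space_std_normal]) measurable
  also have "\<dots> = (\<integral>\<^sup>+w. ennreal (L2_set (?x k w) {..<d} powr s) * ?m \<partial>white_noise)"
    by (simp only: split nn_integral_sgd_step_powr[OF finite_atLeastAtMost d_pos] batch)
  also have "\<dots> = (\<integral>\<^sup>+w. ennreal (L2_set (?x k w) {..<d} powr s) \<partial>white_noise) * ?m"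
    by (rule nn_integral_multc) measurable
  finally show ?case
    by (simp add: Suc.IH mult_ac)
qed

section \<open>Integrability of the gain\<close>

lemma powr_sum_le:
  fixes x :: "'a \<Rightarrow> real"
  assumes finite_J: "finite J" and x_nonneg: "\<And>j. j \<in> J \<Longrightarrow> x j \<ge> 0" and "s \<ge> 0"
  shows "(\<Sum>j\<in>J. x j) powr s \<le> real (card J) powr s * (\<Sum>j\<in>J. x j powr s)"
proof (cases "J = {}")
  case False
  define m where "m = Max (x ` J)"
  have x_le_m: "x j \<le> m" if "j \<in> J" for j
    unfolding m_def using finite_J that by (intro Max_ge) auto
  have "m \<in> x ` J"
    unfolding m_def using finite_J False by (intro Max_in) auto
  then obtain k where k_maximal: "k \<in> J" "x k = m" by auto
  have "(\<Sum>j\<in>J. x j) powr s \<le> (real (card J) * m) powr s"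
    using x_nonneg x_le_m \<open>s \<ge> 0\<close> by (intro powr_mono2 sum_nonneg sum_bounded_above) auto
  also have "\<dots> = real (card J) powr s * x k powr s"
    using x_nonneg[OF k_maximal(1)] k_maximal(2) by (simp add: powr_mult)
  also have "\<dots> \<le> real (card J) powr s * (\<Sum>j\<in>J. x j powr s)"
    using finite_J k_maximal(1) by (intro mult_left_mono member_le_sum) auto
  finally show ?thesis .
qed simp

definition has_all_moments :: "'a measure \<Rightarrow> ('a \<Rightarrow> real) \<Rightarrow> bool" where
  "has_all_moments M f \<longleftrightarrow> f \<in> borel_measurable M \<and> (\<forall>s>0. integrable M (\<lambda>x. \<bar>f x\<bar> powr s))"

lemma has_all_moments_bound:
  assumes moments_g: "has_all_moments M g" and [measurable]: "f \<in> borel_measurable M"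
    and f_le_g: "\<And>x. \<bar>f x\<bar> \<le> \<bar>g x\<bar>"
  shows "has_all_moments M f"
  unfolding has_all_moments_def
proof (intro conjI allI impI)
  fix s :: real assume "s > 0"
  then have "integrable M (\<lambda>x. \<bar>g x\<bar> powr s)"
    using moments_g by (simp add: has_all_moments_def)
  then show "integrable M (\<lambda>x. \<bar>f x\<bar> powr s)"
    by (rule Bochner_Integration.integrable_bound)
       (use f_le_g \<open>s > 0\<close> in \<open>auto intro!: AE_I2 powr_mono2\<close>)
qed fact

lemma has_all_moments_mult:
  assumes "has_all_moments M f" "has_all_moments M g"
  shows "has_all_moments M (\<lambda>x. f x * g x)"
  unfolding has_all_moments_def
proof (intro conjI allI impI)
  have [measurable]: "f \<in> borel_measurable M" "g \<in> borel_measurable M"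
    using assms by (simp_all add: has_all_moments_def)
  show "(\<lambda>x. f x * g x) \<in> borel_measurable M" by measurable
  fix s :: real assume "s > 0"
  then have "integrable M (\<lambda>x. \<bar>f x\<bar> powr (2 * s) + \<bar>g x\<bar> powr (2 * s))"
    using assms by (simp add: has_all_moments_def)
  then show "integrable M (\<lambda>x. \<bar>f x * g x\<bar> powr s)"
  proof (rule Bochner_Integration.integrable_bound)
    have "\<bar>f x * g x\<bar> powr s \<le> \<bar>f x\<bar> powr (2 * s) + \<bar>g x\<bar> powr (2 * s)" for x
    proof -
      have "\<bar>f x * g x\<bar> powr s = \<bar>f x\<bar> powr s * \<bar>g x\<bar> powr s"
        by (simp add: abs_mult powr_mult)
      also have "\<dots> \<le> 2 * (\<bar>f x\<bar> powr s) * (\<bar>g x\<bar> powr s)"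
        by simp
      also have "\<dots> \<le> (\<bar>f x\<bar> powr s)\<^sup>2 + (\<bar>g x\<bar> powr s)\<^sup>2"
        by (rule sum_squares_bound)
      finally show ?thesis
        by (simp add: power2_eq_square flip: powr_add)
    qed
    then show "AE x in M. norm (\<bar>f x * g x\<bar> powr s)
        \<le> norm (\<bar>f x\<bar> powr (2 * s) + \<bar>g x\<bar> powr (2 * s))"
      by simp
  qed measurable
qed

lemma has_all_moments_sum:
  assumes finite_J: "finite J" and moments_f: "\<And>j. j \<in> J \<Longrightarrow> has_all_moments M (f j)"
  shows "has_all_moments M (\<lambda>x. \<Sum>j\<in>J. f j x)"
  unfolding has_all_moments_def
proof (intro conjI allI impI)
  have [measurable]: "\<And>j. j \<in> J \<Longrightarrow> f j \<in> borel_measurable M"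
    using moments_f by (simp add: has_all_moments_def)
  show "(\<lambda>x. \<Sum>j\<in>J. f j x) \<in> borel_measurable M" by measurable
  fix s :: real assume "s > 0"
  then have "integrable M (\<lambda>x. real (card J) powr s * (\<Sum>j\<in>J. \<bar>f j x\<bar> powr s))"
    using moments_f by (simp add: has_all_moments_def)
  then show "integrable M (\<lambda>x. \<bar>\<Sum>j\<in>J. f j x\<bar> powr s)"
  proof (rule Bochner_Integration.integrable_bound)
    have "\<bar>\<Sum>j\<in>J. f j x\<bar> powr s \<le> real (card J) powr s * (\<Sum>j\<in>J. \<bar>f j x\<bar> powr s)" for x
    proof -
      have "\<bar>\<Sum>j\<in>J. f j x\<bar> powr s \<le> (\<Sum>j\<in>J. \<bar>f j x\<bar>) powr s"
        using \<open>s > 0\<close> by (intro powr_mono2) auto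
      also have "\<dots> \<le> real (card J) powr s * (\<Sum>j\<in>J. \<bar>f j x\<bar> powr s)"
        using finite_J \<open>s > 0\<close> by (intro powr_sum_le) auto
      finally show ?thesis .
    qed
    then show "AE x in M. norm (\<bar>\<Sum>j\<in>J. f j x\<bar> powr s)
        \<le> norm (real (card J) powr s * (\<Sum>j\<in>J. \<bar>f j x\<bar> powr s))"
      by (simp add: sum_nonneg)
  qed measurable
qed

lemma has_all_moments_add:
  assumes "has_all_moments M f" "has_all_moments M g"
  shows "has_all_moments M (\<lambda>x. f x + g x)"
proof -
  have "has_all_moments M (\<lambda>x. if b then f x else g x)" for b
    using assms by (cases b) simp_all
  then show ?thesis
    using has_all_moments_sum[of "{True, False}" M "\<lambda>b x. if b then f x else g x"] by simp
qed

lemma (in finite_measure) has_all_moments_const: "has_all_moments M (\<lambda>x. c)"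
  by (simp add: has_all_moments_def)

lemma has_all_moments_std_normal: "has_all_moments std_normal (\<lambda>x. x)"
  unfolding has_all_moments_def
proof (intro conjI allI impI)
  fix s :: real assume s_pos: "s > 0"
  define n where "n = nat \<lceil>s\<rceil>"
  interpret prob_space std_normal by (rule prob_space_std_normal)
  have "integrable std_normal (\<lambda>x. 1 + \<bar>x\<bar> ^ n)"
    using integrable_std_normal_moment_abs[of n] by (simp add: integrable_density)
  then show "integrable std_normal (\<lambda>x. \<bar>x\<bar> powr s)"
  proof (rule Bochner_Integration.integrable_bound)
    have "y powr s \<le> 1 + y ^ n" if "y \<ge> 0" for y :: real
    proof (cases "y \<le> 1")
      case True
      then have "y powr s \<le> 1"
        using that s_pos by (intro powr_le1) auto
      then show ?thesis using that by (simp add: add_increasing2)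
    next
      case False
      then have "y powr s \<le> y powr real n"
        using real_nat_ceiling_ge[of s] by (intro powr_mono) (auto simp: n_def)
      then show ?thesis using False by (simp add: powr_realpow)
    qed
    then show "AE x in std_normal. norm (\<bar>x\<bar> powr s) \<le> norm (1 + \<bar>x\<bar> ^ n)"
      by (auto intro!: AE_I2 order_trans[OF _ abs_ge_self])
  qed simp
qed simp

lemma has_all_moments_white_noise: "has_all_moments white_noise (\<lambda>w. w i)"
proof -
  have "integrable white_noise (\<lambda>w. \<bar>w i\<bar> powr s)" if "s > 0" for s
    using has_all_moments_std_normal that
      distr_PiM_component[of UNIV "\<lambda>_. std_normal" i]
      integrable_distr_eq[of "\<lambda>w. w i" white_noise std_normal "\<lambda>x. \<bar>x\<bar> powr s"]
    by (simp add: has_all_moments_def prob_space_std_normal)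
  then show ?thesis
    by (simp add: has_all_moments_def)
qed

lemma has_all_moments_gain:
  assumes "finite I"
  shows "has_all_moments white_noise (gain \<kappa> I d)"
proof -
  interpret prob_space "white_noise :: (nat \<times> nat \<Rightarrow> real) measure" by (rule prob_space_white_noise)
  have "has_all_moments white_noise (\<lambda>w. first_column \<kappa> I w p)" for p
  proof -
    have "has_all_moments white_noise (\<lambda>w. indicator {0} p + (\<Sum>i\<in>I. - \<kappa> * (w (i, p) * w (i, 0))))"
      using assms
      by (intro has_all_moments_add has_all_moments_sum has_all_moments_mult has_all_moments_const
          has_all_moments_white_noise)
    then show ?thesis
      by (simp add: first_column_def sum_distrib_left sum_negf)
  qed
  then have "has_all_moments white_noise (\<lambda>w. \<bar>first_column \<kappa> I w p\<bar>)" for p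
    by (rule has_all_moments_bound[where g="\<lambda>w. first_column \<kappa> I w p"]) simp_all
  then have "has_all_moments white_noise (\<lambda>w. \<Sum>p<d. \<bar>first_column \<kappa> I w p\<bar>)"
    by (intro has_all_moments_sum) auto
  then show ?thesis
  proof (rule has_all_moments_bound)
    show "\<bar>gain \<kappa> I d w\<bar> \<le> \<bar>\<Sum>p<d. \<bar>first_column \<kappa> I w p\<bar>\<bar>" for w
      using L2_set_le_sum_abs[of "first_column \<kappa> I w" "{..<d}"] by (simp add: gain_def)
  qed measurable
qed

lemma nn_integral_abs_diff_powr_le:
  fixes f :: "real \<Rightarrow> real"
  assumes "prob_space (density lborel f)" and [measurable]: "f \<in> borel_measurable borel"
    and f_le: "\<And>x. f x \<le> c" and q_bounds: "0 \<le> q" "q < 1"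
  shows "(\<integral>\<^sup>+x. ennreal (\<bar>x - r\<bar> powr - q) \<partial>density lborel f)
      \<le> 1 + ennreal c * ennreal (2 / (1 - q))"
proof -
  interpret prob_space "density lborel f" by fact
  define h where "h y = ennreal (indicator {0..1} y * y powr - q)" for y :: real
  have [measurable]: "h \<in> borel_measurable borel" unfolding h_def by measurable
  have nn_integral_h: "(\<integral>\<^sup>+y. h y \<partial>lborel) = ennreal (1 / (1 - q))"
    using nn_integral_has_integral_lebesgue[OF _ has_integral_powr_from_0[of "- q" 1]] q_bounds
    by (simp add: h_def)
  have bound: "ennreal (\<bar>y\<bar> powr - q) \<le> 1 + (h y + h (- y))" for y
  proof (cases "\<bar>y\<bar> \<le> 1")
    case True
    then have "ennreal (\<bar>y\<bar> powr - q) \<le> h y + h (- y)"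
      by (cases "y \<ge> 0") (auto simp: h_def indicator_def)
    then show ?thesis by (rule order_trans) simp
  next
    case False
    then have "\<bar>y\<bar> powr - q \<le> \<bar>y\<bar> powr 0"
      using q_bounds by (intro powr_mono) auto
    then have "ennreal (\<bar>y\<bar> powr - q) \<le> 1"
      using False by (simp add: ennreal_le_1 split: if_splits)
    then show ?thesis by (rule order_trans) simp
  qed
  have shift: "(\<integral>\<^sup>+x. h (x - r) \<partial>lborel) = ennreal (1 / (1 - q))"
      "(\<integral>\<^sup>+x. h (r - x) \<partial>lborel) = ennreal (1 / (1 - q))"
    using nn_integral_real_affine[of h 1 "- r"] nn_integral_real_affine[of h "-1" r] nn_integral_h
    by simp_all
  have "(\<integral>\<^sup>+x. ennreal (\<bar>x - r\<bar> powr - q) \<partial>density lborel f)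
      \<le> (\<integral>\<^sup>+x. 1 + (h (x - r) + h (r - x)) \<partial>density lborel f)"
    using bound[of "x - r" for x] by (intro nn_integral_mono) simp
  also have "\<dots> = 1 + (\<integral>\<^sup>+x. ennreal (f x) * (h (x - r) + h (r - x)) \<partial>lborel)"
    using emeasure_space_1 by (subst nn_integral_add) (simp_all add: nn_integral_density)
  also have "\<dots> \<le> 1 + (\<integral>\<^sup>+x. ennreal c * (h (x - r) + h (r - x)) \<partial>lborel)"
    using f_le by (intro add_left_mono nn_integral_mono mult_right_mono ennreal_leI) auto
  also have "\<dots> = 1 + ennreal c * ennreal (2 / (1 - q))"
    using q_bounds by (simp add: nn_integral_cmult nn_integral_add shift flip: ennreal_plus)
  finally show ?thesis .
qed

lemma abs_quadratic_ge:
  fixes x C \<kappa> :: real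
  assumes "\<kappa> > 0"
  shows "\<kappa> * (\<bar>x\<bar> - sqrt (max (C / \<kappa>) 0))\<^sup>2 \<le> \<bar>C - \<kappa> * x\<^sup>2\<bar>"
proof -
  define D where "D = C / \<kappa>"
  have "(\<bar>x\<bar> - sqrt (max D 0))\<^sup>2 \<le> \<bar>D - x\<^sup>2\<bar>"
  proof (cases "D \<ge> 0")
    case True
    define r where "r = sqrt D"
    have r_props: "r \<ge> 0" "D = r\<^sup>2" using True by (simp_all add: r_def)
    have "(\<bar>x\<bar> - r)\<^sup>2 = \<bar>r - \<bar>x\<bar>\<bar> * \<bar>r - \<bar>x\<bar>\<bar>"
      by (simp add: power2_commute flip: power2_eq_square)
    also have "\<dots> \<le> \<bar>r - \<bar>x\<bar>\<bar> * (r + \<bar>x\<bar>)"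
      using r_props by (intro mult_left_mono) auto
    also have "\<dots> = \<bar>(r - \<bar>x\<bar>) * (r + \<bar>x\<bar>)\<bar>"
      using r_props by (simp add: abs_mult)
    also have "(r - \<bar>x\<bar>) * (r + \<bar>x\<bar>) = D - x\<^sup>2"
      by (simp add: r_props algebra_simps power2_eq_square flip: abs_mult)
    finally show ?thesis using True by (simp add: r_def)
  qed (simp add: max_def)
  then have "\<kappa> * (\<bar>x\<bar> - sqrt (max D 0))\<^sup>2 \<le> \<kappa> * \<bar>D - x\<^sup>2\<bar>"
    using assms by (intro mult_left_mono) auto
  also have "\<dots> = \<bar>C - \<kappa> * x\<^sup>2\<bar>"
    using assms by (simp add: D_def abs_mult_pos' right_diff_distrib)
  finally show ?thesis by (simp add: D_def)
qed

lemma AE_std_normal_abs_neq: "AE x in std_normal. \<bar>x\<bar> \<noteq> r"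
proof -
  have "finite {x :: real. \<bar>x\<bar> = r}"
    by (rule finite_subset[of _ "{r, - r}"]) auto
  then have "AE x in lborel. x \<notin> {x. \<bar>x\<bar> = r}"
    by (intro AE_not_in finite_imp_null_set_lborel)
  then show ?thesis
    by (auto simp: AE_density)
qed

lemma AE_std_normal_quadratic_neq:
  assumes "\<kappa> > 0"
  shows "AE x in std_normal. C - \<kappa> * x\<^sup>2 \<noteq> 0"
  using AE_std_normal_abs_neq[of "sqrt (max (C / \<kappa>) 0)"]
proof eventually_elim
  case (elim x)
  then have "0 < \<kappa> * (\<bar>x\<bar> - sqrt (max (C / \<kappa>) 0))\<^sup>2"
    using assms by simp
  also have "\<dots> \<le> \<bar>C - \<kappa> * x\<^sup>2\<bar>"
    by (rule abs_quadratic_ge[OF assms])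
  finally show ?case by simp
qed

lemma power2_powr: "x\<^sup>2 powr a = \<bar>x\<bar> powr (2 * a)" for x :: real
proof -
  have "x\<^sup>2 = \<bar>x\<bar> * \<bar>x\<bar>"
    by (simp add: power2_eq_square)
  then show ?thesis
    by (simp only: powr_mult abs_ge_zero mult_2 powr_add)
qed

lemma abs_quadratic_powr_le:
  fixes x C \<kappa> p :: real
  defines "r \<equiv> sqrt (max (C / \<kappa>) 0)"
  assumes kappa_pos: "\<kappa> > 0" and p_nonneg: "p \<ge> 0" and x_neq: "\<bar>x\<bar> \<noteq> r"
  shows "\<bar>C - \<kappa> * x\<^sup>2\<bar> powr - p \<le> \<kappa> powr - p * (\<bar>x - r\<bar> powr - (2 * p) + \<bar>x - (- r)\<bar> powr - (2 * p))"
proof -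
  have "\<bar>C - \<kappa> * x\<^sup>2\<bar> powr - p \<le> (\<kappa> * (\<bar>x\<bar> - r)\<^sup>2) powr - p"
    using x_neq kappa_pos p_nonneg abs_quadratic_ge[OF kappa_pos, of x C]
    by (intro powr_mono2') (auto simp: r_def)
  also have "\<dots> = \<kappa> powr - p * \<bar>\<bar>x\<bar> - r\<bar> powr - (2 * p)"
    using kappa_pos power2_powr[of "\<bar>x\<bar> - r" "- p"] by (simp add: powr_mult)
  also have "\<dots> \<le> \<kappa> powr - p * (\<bar>x - r\<bar> powr - (2 * p) + \<bar>x - (- r)\<bar> powr - (2 * p))"
  proof (intro mult_left_mono)
    have "\<bar>\<bar>x\<bar> - r\<bar> = \<bar>x - r\<bar> \<or> \<bar>\<bar>x\<bar> - r\<bar> = \<bar>x - (- r)\<bar>"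
      by linarith
    then show "\<bar>\<bar>x\<bar> - r\<bar> powr - (2 * p) \<le> \<bar>x - r\<bar> powr - (2 * p) + \<bar>x - (- r)\<bar> powr - (2 * p)"
      by auto
  qed simp
  finally show ?thesis .
qed

lemma nn_integral_std_normal_quadratic_powr:
  assumes kappa_pos: "\<kappa> > 0" and p_bounds: "0 \<le> p" "p < 1/2"
  obtains K where "K < \<infinity>" "\<And>C. (\<integral>\<^sup>+x. ennreal (\<bar>C - \<kappa> * x\<^sup>2\<bar> powr - p) \<partial>std_normal) \<le> K"
proof
  define c where "c = 1 / sqrt (2 * pi)"
  let ?B = "1 + ennreal c * ennreal (2 / (1 - 2 * p))"
  show "ennreal (\<kappa> powr - p) * (?B + ?B) < \<infinity>"
    by (simp add: ennreal_mult_less_top)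
  fix C :: real
  define r where "r = sqrt (max (C / \<kappa>) 0)"
  let ?h = "\<lambda>r x. ennreal (\<bar>x - r\<bar> powr - (2 * p))"
  have "std_normal_density x \<le> c" for x
    by (simp add: std_normal_density_def c_def divide_right_mono)
  then have nn_integral_le_B: "(\<integral>\<^sup>+x. ?h r x \<partial>std_normal) \<le> ?B" for r
    using p_bounds by (intro nn_integral_abs_diff_powr_le prob_space_std_normal) auto
  have "AE x in std_normal. ennreal (\<bar>C - \<kappa> * x\<^sup>2\<bar> powr - p)
      \<le> ennreal (\<kappa> powr - p) * (?h r x + ?h (- r) x)"
    using AE_std_normal_abs_neq[of r]
  proof eventually_elim
    case (elim x)
    then show ?case
      using abs_quadratic_powr_le[OF kappa_pos p_bounds(1), of x C]
      by (simp add: ennreal_leI r_def flip: ennreal_mult' ennreal_plus)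
  qed
  then have "(\<integral>\<^sup>+x. ennreal (\<bar>C - \<kappa> * x\<^sup>2\<bar> powr - p) \<partial>std_normal)
      \<le> (\<integral>\<^sup>+x. ennreal (\<kappa> powr - p) * (?h r x + ?h (- r) x) \<partial>std_normal)"
    by (rule nn_integral_mono_AE)
  also have "\<dots> = ennreal (\<kappa> powr - p) * ((\<integral>\<^sup>+x. ?h r x \<partial>std_normal) + (\<integral>\<^sup>+x. ?h (- r) x \<partial>std_normal))"
    by (simp add: nn_integral_cmult nn_integral_add)
  also have "\<dots> \<le> ennreal (\<kappa> powr - p) * (?B + ?B)"
    by (intro mult_left_mono add_mono nn_integral_le_B) simp
  finally show "(\<integral>\<^sup>+x. ennreal (\<bar>C - \<kappa> * x\<^sup>2\<bar> powr - p) \<partial>std_normal)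
      \<le> ennreal (\<kappa> powr - p) * (?B + ?B)" .
qed

lemma gain_ge_fun_upd:
  assumes "d \<ge> 1" "finite I" "a \<in> I"
  shows "\<bar>(1 - \<kappa> * (\<Sum>i\<in>I - {a}. (w (i, 0))\<^sup>2)) - \<kappa> * x\<^sup>2\<bar> \<le> gain \<kappa> I d (w((a, 0) := x))"
proof -
  have "(\<Sum>i\<in>I. ((w((a, 0) := x)) (i, 0))\<^sup>2) = x\<^sup>2 + (\<Sum>i\<in>I - {a}. (w (i, 0))\<^sup>2)"
    using assms(2,3) by (subst sum.remove[of I a]) (auto intro!: sum.cong)
  then have "first_column \<kappa> I (w((a, 0) := x)) 0 = (1 - \<kappa> * (\<Sum>i\<in>I - {a}. (w (i, 0))\<^sup>2)) - \<kappa> * x\<^sup>2"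
    by (simp add: first_column_def algebra_simps flip: power2_eq_square)
  then show ?thesis
    using abs_le_L2_set[of "{..<d}" 0 "first_column \<kappa> I (w((a, 0) := x))"] assms(1)
    by (simp add: gain_def)
qed

lemma AE_gain_pos:
  assumes d_pos: "d \<ge> 1" and batch: "finite I" "I \<noteq> {}" and kappa_pos: "\<kappa> > 0"
  shows "AE w in white_noise. gain \<kappa> I d w > 0"
proof -
  obtain a where a_in_I: "a \<in> I" using batch by auto
  show ?thesis
  proof (rule AE_PiM_fun_upd[OF prob_space_std_normal])
    fix w :: "nat \<times> nat \<Rightarrow> real"
    show "AE x in std_normal. gain \<kappa> I d (w((a, 0) := x)) > 0"
      using AE_std_normal_quadratic_neq[OF kappa_pos, of "1 - \<kappa> * (\<Sum>i\<in>I - {a}. (w (i, 0))\<^sup>2)"]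
    proof eventually_elim
      case (elim x)
      then show ?case
        using gain_ge_fun_upd[OF d_pos batch(1) a_in_I, of \<kappa> w x] by linarith
    qed
  qed measurable
qed

lemma nn_integral_gain_neg_powr_finite:
  assumes d_pos: "d \<ge> 1" and batch: "finite I" "I \<noteq> {}" and kappa_pos: "\<kappa> > 0"
    and p_bounds: "0 \<le> p" "p < 1/2"
  shows "(\<integral>\<^sup>+w. ennreal (gain \<kappa> I d w powr - p) \<partial>white_noise) < \<infinity>"
proof -
  interpret prob_space "white_noise :: (nat \<times> nat \<Rightarrow> real) measure" by (rule prob_space_white_noise)
  obtain a where a_in_I: "a \<in> I" using batch by auto
  obtain K where K_bound: "K < \<infinity>" "\<And>C. (\<integral>\<^sup>+x. ennreal (\<bar>C - \<kappa> * x\<^sup>2\<bar> powr - p) \<partial>std_normal) \<le> K"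
    using nn_integral_std_normal_quadratic_powr[OF kappa_pos p_bounds] by blast
  have "(\<integral>\<^sup>+x. ennreal (gain \<kappa> I d (w((a, 0) := x)) powr - p) \<partial>std_normal) \<le> K" for w
  proof -
    define C where "C = 1 - \<kappa> * (\<Sum>i\<in>I - {a}. (w (i, 0))\<^sup>2)"
    have "AE x in std_normal. ennreal (gain \<kappa> I d (w((a, 0) := x)) powr - p)
        \<le> ennreal (\<bar>C - \<kappa> * x\<^sup>2\<bar> powr - p)"
      using AE_std_normal_quadratic_neq[OF kappa_pos, of C]
    proof eventually_elim
      case (elim x)
      then show ?case
        using gain_ge_fun_upd[OF d_pos batch(1) a_in_I, of \<kappa> w x] p_bounds
        by (intro ennreal_leI powr_mono2') (auto simp: C_def)
    qed
    then have "(\<integral>\<^sup>+x. ennreal (gain \<kappa> I d (w((a, 0) := x)) powr - p) \<partial>std_normal)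
        \<le> (\<integral>\<^sup>+x. ennreal (\<bar>C - \<kappa> * x\<^sup>2\<bar> powr - p) \<partial>std_normal)"
      by (rule nn_integral_mono_AE)
    then show ?thesis
      using K_bound(2)[of C] by (rule order_trans)
  qed
  then have "(\<integral>\<^sup>+w. \<integral>\<^sup>+x. ennreal (gain \<kappa> I d (w((a, 0) := x)) powr - p) \<partial>std_normal \<partial>white_noise)
      \<le> (\<integral>\<^sup>+(w :: nat \<times> nat \<Rightarrow> real). K \<partial>white_noise)"
    by (intro nn_integral_mono) simp
  also have "\<dots> = K"
    using emeasure_space_1 by simp
  finally show ?thesis
    using K_bound(1)
    by (subst nn_integral_PiM_fun_upd[OF prob_space_std_normal, where i="(a, 0)"]) auto
qed

lemma full_support_white_noise: "full_support (white_noise :: ('i::countable \<Rightarrow> real) measure)"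
  by (intro full_support_PiM prob_space_std_normal full_support_density_lborel)
     (simp_all add: normal_density_pos)

lemma integral_white_noise_less:
  fixes f g :: "('i::countable \<Rightarrow> real) \<Rightarrow> real"
  assumes "integrable white_noise f" "integrable white_noise g" "continuous_on UNIV f"
      "continuous_on UNIV g"
    and "\<And>w. f w \<le> g w" "f w < g w"
  shows "(\<integral>w. f w \<partial>white_noise) < (\<integral>w. g w \<partial>white_noise)"
  using assms prob_space_white_noise
  by (intro integral_less_full_support[where x=w] full_support_white_noise)
     (auto simp: prob_space_def)

lemma emeasure_gain_gt_1:
  assumes d_pos: "d \<ge> 1" and batch: "finite I" "I \<noteq> {}" and kappa_pos: "\<kappa> > 0"
  shows "emeasure white_noise {w \<in> space white_noise. gain \<kappa> I d w > 1} \<noteq> 0"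
proof -
  define w :: "nat \<times> nat \<Rightarrow> real" where "w = (\<lambda>_. sqrt (3 / \<kappa>))"
  have "\<kappa> * (\<Sum>i\<in>I. w (i, 0) * w (i, 0)) = 3 * real (card I)"
    using kappa_pos by (simp add: w_def)
  moreover have "real (card I) \<ge> 1"
    using batch by (simp add: Suc_le_eq card_gt_0_iff)
  ultimately have "\<bar>first_column \<kappa> I w 0\<bar> > 1"
    by (simp add: first_column_def)
  then have "gain \<kappa> I d w > 1"
    using abs_le_L2_set[of "{..<d}" 0 "first_column \<kappa> I w"] d_pos by (simp add: gain_def)
  moreover have "open {w. gain \<kappa> I d w > 1}"
    by (intro open_Collect_less continuous_on_gain continuous_on_const)
  ultimately show ?thesis
    using full_support_white_noise by (auto simp: full_support_def)
qed

lemma positive_rv_gain: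
  assumes d_pos: "d \<ge> 1" and batch: "finite I" "I \<noteq> {}" and kappa_pos: "\<kappa> > 0"
  shows "positive_rv white_noise (gain \<kappa> I d) (1/4)"
proof (intro positive_rv.intro positive_rv_axioms.intro prob_space_white_noise)
  show "AE w in white_noise. gain \<kappa> I d w > 0" by (rule AE_gain_pos[OF assms])
  show "emeasure white_noise {w \<in> space white_noise. gain \<kappa> I d w > 1} \<noteq> 0"
    by (rule emeasure_gain_gt_1[OF assms])
  fix s :: real assume s_ge: "s \<ge> - (1/4)"
  show "integrable white_noise (\<lambda>w. gain \<kappa> I d w powr s)"
  proof (cases "s > 0")
    case True
    then show ?thesis
      using has_all_moments_gain[OF batch(1), of \<kappa> d] by (simp add: has_all_moments_def)
  next
    case False
    then show ?thesis
      using nn_integral_gain_neg_powr_finite[OF assms, of "- s"] s_ge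
      by (intro integrableI_bounded) auto
  qed
qed simp_all

section \<open>The functions h and rho\<close>

lemma (in prob_space) AE_eventually_less_power:
  fixes X :: "nat \<Rightarrow> 'a \<Rightarrow> real"
  assumes integrable_X: "\<And>k. integrable M (X k)" and X_nonneg: "\<And>k x. X k x \<ge> 0"
    and expectation_le: "\<And>k. expectation (X k) \<le> g ^ k" and g_less_c: "0 \<le> g" "g < c"
  shows "AE x in M. \<forall>\<^sub>F k in sequentially. X k x < c ^ k"
proof -
  define A where "A k = {x \<in> space M. X k x \<ge> c ^ k}" for k
  have [measurable]: "A k \<in> sets M" for k
    using integrable_X[of k] unfolding A_def by measurable
  have "prob (A k) \<le> (g / c) ^ k" for k
  proof -
    have "prob (A k) \<le> expectation (X k) / c ^ k"
      unfolding A_def using integrable_X X_nonneg g_less_c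
      by (intro integral_Markov_inequality_measure[OF _ sets.top]) auto
    also have "\<dots> \<le> (g / c) ^ k"
      using expectation_le[of k] g_less_c by (simp add: power_divide divide_right_mono)
    finally show ?thesis .
  qed
  then have "summable (\<lambda>k. prob (A k))"
    using g_less_c by (intro summable_comparison_test'[OF summable_geometric[of "g / c"]]) auto
  then have "AE x in M. \<forall>\<^sub>F k in sequentially. x \<in> space M - A k"
    by (intro borel_cantelli_AE1) (auto simp: emeasure_eq_measure)
  then show ?thesis
    by eventually_elim (auto simp: A_def not_le elim: eventually_mono)
qed

lemma AE_tendstoI:
  fixes f :: "'b \<Rightarrow> 'a \<Rightarrow> 'c::metric_space"
  assumes "\<And>\<epsilon>. \<epsilon> > 0 \<Longrightarrow> AE x in M. \<forall>\<^sub>F k in F. dist (f k x) l < \<epsilon>"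
  shows "AE x in M. ((\<lambda>k. f k x) \<longlongrightarrow> l) F"
proof -
  have "AE x in M. \<forall>n. \<forall>\<^sub>F k in F. dist (f k x) l < inverse (real (Suc n))"
    unfolding AE_all_countable by (intro allI assms) simp
  then show ?thesis
  proof eventually_elim
    case (elim x)
    show ?case
    proof (rule tendstoI)
      fix \<epsilon> :: real assume "\<epsilon> > 0"
      then obtain n where "inverse (real (Suc n)) < \<epsilon>"
        using reals_Archimedean by blast
      then show "\<forall>\<^sub>F k in F. dist (f k x) l < \<epsilon>"
        using elim[rule_format, of n] by (auto elim: eventually_mono)
    qed
  qed
qed

lemma power_sandwich_root_tendsto:
  fixes a :: "nat \<Rightarrow> real"
  assumes "g > 0" "C > 0" and lower: "\<And>k. g ^ k \<le> a k" and upper: "\<And>k. a k \<le> C * g ^ k"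
  shows "(\<lambda>k. a k powr (1 / real k)) \<longlonglongrightarrow> g"
proof (rule real_tendsto_sandwich)
  have root: "(g ^ k) powr (1 / real k) = g" if "k > 0" for k
    using \<open>g > 0\<close> that by (simp add: powr_powr flip: powr_realpow)
  show "\<forall>\<^sub>F k in sequentially. g \<le> a k powr (1 / real k)"
    using eventually_gt_at_top[of 0]
  proof eventually_elim
    case (elim k)
    show ?case
      using powr_mono2[OF _ _ lower[of k], of "1 / real k"] root[OF elim] \<open>g > 0\<close> by simp
  qed
  show "\<forall>\<^sub>F k in sequentially. a k powr (1 / real k) \<le> C powr (1 / real k) * g"
    using eventually_gt_at_top[of 0]
  proof eventually_elim
    case (elim k)
    have "0 \<le> a k"
      using lower[of k] \<open>g > 0\<close> by (meson less_imp_le order_trans zero_less_power)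
    then show ?case
      using powr_mono2[OF _ _ upper[of k], of "1 / real k"] root[OF elim] by (simp add: powr_mult)
  qed
  have "(\<lambda>k. C powr (1 / real k) * g) \<longlonglongrightarrow> C powr 0 * g"
    using \<open>C > 0\<close> by (intro tendsto_intros lim_1_over_n) auto
  then show "(\<lambda>k. C powr (1 / real k) * g) \<longlonglongrightarrow> g"
    using \<open>C > 0\<close> by simp
qed simp

lemma ln_div_bounds:
  fixes k x :: real
  assumes "k > 0" "C > 0" "exp (k * l) \<le> x" "x \<le> C * exp (k * u)"
  shows "l \<le> ln x / k" "ln x / k \<le> ln C / k + u"
proof -
  have x_pos: "x > 0"
    using assms(3) by (meson exp_gt_zero less_le_trans)
  then have "k * l \<le> ln x"
    using assms(3) by (simp add: ln_ge_iff)
  then show "l \<le> ln x / k"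
    using assms(1) by (simp add: pos_le_divide_eq mult.commute)
  have "ln x \<le> ln (C * exp (k * u))"
    using x_pos assms by simp
  also have "\<dots> = ln C + k * u"
    using assms by (simp add: ln_mult)
  finally show "ln x / k \<le> ln C / k + u"
    using assms(1) by (simp add: field_simps)
qed

lemma data_space_1: "data_space 1 = white_noise"
  by (simp add: data_space_def)

locale unit_variance_sgd =
  fixes \<eta> :: real and b d :: nat
  assumes \<eta>_pos: "\<eta> > 0" and b_pos: "b \<ge> 1" and d_pos: "d \<ge> 1"
begin

abbreviation step_gain :: "(nat \<times> nat \<Rightarrow> real) \<Rightarrow> real" where
  "step_gain \<equiv> gain (\<eta> / real b) {1..b} d"

sublocale positive_rv white_noise step_gain "1/4"
  using \<eta>_pos b_pos d_pos by (intro positive_rv_gain) auto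

abbreviation lyapunov_exponent :: real where
  "lyapunov_exponent \<equiv> expectation (\<lambda>w. ln (step_gain w))"

definition column_norm :: "nat \<Rightarrow> nat \<Rightarrow> (nat \<times> nat \<Rightarrow> real) \<Rightarrow> real" where
  "column_norm j k w = vnorm (col (Pimat \<eta> b d w k) j)"

definition product_norm :: "nat \<Rightarrow> (nat \<times> nat \<Rightarrow> real) \<Rightarrow> real" where
  "product_norm k w = spec_norm d (Pimat \<eta> b d w k)"

lemma column_norm_nonneg [simp]: "column_norm j k w \<ge> 0"
  by (simp add: column_norm_def)

lemma product_norm_nonneg [simp]: "product_norm k w \<ge> 0"
  by (simp add: product_norm_def spec_norm_nonneg[OF Pimat_carrier d_pos])

lemma column_norm_eq:
  "j < d \<Longrightarrow> column_norm j k w = L2_set (sgd_iterate (\<eta> / real b) b d w k (indicator {j})) {..<d}"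
  by (simp add: column_norm_def vnorm_col_Pimat)

lemma measurable_column_norm [measurable]: "j < d \<Longrightarrow> column_norm j k \<in> borel_measurable white_noise"
  by (subst measurable_cong[OF column_norm_eq]) measurable

lemma measurable_product_norm [measurable]: "product_norm k \<in> borel_measurable white_noise"
  unfolding product_norm_def using d_pos by measurable

lemma column_norm_le_product_norm: "j < d \<Longrightarrow> column_norm j k w \<le> product_norm k w"
  by (simp add: column_norm_def product_norm_def vnorm_col_le_spec_norm[OF Pimat_carrier])

lemma product_norm_le_sum_column_norm: "product_norm k w \<le> (\<Sum>j<d. column_norm j k w)"
  by (simp add: column_norm_def product_norm_def spec_norm_le_sum_col[OF Pimat_carrier d_pos])

lemma moment_column_norm:
  assumes "s \<ge> - (1/4)" "j < d"
  shows "integrable white_noise (\<lambda>w. column_norm j k w powr s)"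
    and "moment white_noise (column_norm j k) s = moment white_noise step_gain s ^ k"
proof -
  have "(\<integral>\<^sup>+w. ennreal (step_gain w powr s) \<partial>white_noise) = ennreal (moment white_noise step_gain s)"
    unfolding moment_def using integrable_powr[OF assms(1)] by (intro nn_integral_eq_integral) auto
  then have "(\<integral>\<^sup>+w. ennreal (column_norm j k w powr s) \<partial>white_noise)
      = ennreal (moment white_noise step_gain s ^ k)"
    using assms(2) nn_integral_sgd_iterate_powr[OF d_pos, of "\<eta> / real b" b k "indicator {j}" s]
    by (simp add: column_norm_eq L2_set_indicator_singleton ennreal_power)
  then show "integrable white_noise (\<lambda>w. column_norm j k w powr s)"
    "moment white_noise (column_norm j k) s = moment white_noise step_gain s ^ k"
    using assms(2) nn_integral_eq_integrable[of "\<lambda>w. column_norm j k w powr s" white_noise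
        "moment white_noise step_gain s ^ k"]
    by (simp_all add: moment_def)
qed

lemma AE_column_norm_pos:
  assumes "j < d"
  shows "AE w in white_noise. column_norm j k w > 0"
proof -
  have "{w \<in> space white_noise. column_norm j k w > 0} \<in> sets white_noise"
    using assms by measurable
  then have pos_sets: "{w. column_norm j k w > 0} \<in> sets white_noise"
    by simp
  have "moment white_noise (column_norm j k) 0 = expectation (indicator {w. column_norm j k w > 0})"
    unfolding moment_def
    by (intro Bochner_Integration.integral_cong) (auto simp: indicator_def less_le)
  then have "prob {w. column_norm j k w > 0} = 1"
    using moment_column_norm(2)[of 0 j k] moment_0 assms pos_sets by simp
  then show ?thesis
    using AE_in_set_eq_1[OF pos_sets] by simp
qed

lemma moment_product_norm_bounds:
  assumes s_pos: "s > 0"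
  shows "moment white_noise step_gain s ^ k \<le> moment white_noise (product_norm k) s"
    and "moment white_noise (product_norm k) s
        \<le> (real d powr s * real d) * moment white_noise step_gain s ^ k"
proof -
  have powr_le: "product_norm k w powr s \<le> real d powr s * (\<Sum>j<d. column_norm j k w powr s)" for w
  proof -
    have "product_norm k w powr s \<le> (\<Sum>j<d. column_norm j k w) powr s"
      using s_pos by (intro powr_mono2 product_norm_le_sum_column_norm) auto
    also have "\<dots> \<le> real d powr s * (\<Sum>j<d. column_norm j k w powr s)"
      using powr_sum_le[of "{..<d}" "\<lambda>j. column_norm j k w" s] s_pos by simp
    finally show ?thesis .
  qed
  have column_moments: "integrable white_noise (\<lambda>w. column_norm j k w powr s)"
    "(\<integral>w. column_norm j k w powr s \<partial>white_noise) = moment white_noise step_gain s ^ k"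
      if "j < d" for j
    using moment_column_norm[of s j k] s_pos that by (simp_all add: moment_def)
  then have integrable_sum_column_norm:
      "integrable white_noise (\<lambda>w. real d powr s * (\<Sum>j<d. column_norm j k w powr s))"
    by (intro integrable_mult_right Bochner_Integration.integrable_sum) simp
  then have integrable_product_norm: "integrable white_noise (\<lambda>w. product_norm k w powr s)"
    by (rule Bochner_Integration.integrable_bound)
       (use powr_le in \<open>auto intro!: AE_I2 order_trans[OF _ abs_ge_self]\<close>)
  have "moment white_noise step_gain s ^ k = (\<integral>w. column_norm 0 k w powr s \<partial>white_noise)"
    using column_moments(2)[of 0] d_pos by simp
  also have "\<dots> \<le> moment white_noise (product_norm k) s"
    unfolding moment_def using s_pos d_pos column_moments(1)[of 0]
    by (intro integral_mono integrable_product_norm powr_mono2 column_norm_le_product_norm) auto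
  finally show "moment white_noise step_gain s ^ k \<le> moment white_noise (product_norm k) s" .
  have "moment white_noise (product_norm k) s
      \<le> (\<integral>w. real d powr s * (\<Sum>j<d. column_norm j k w powr s) \<partial>white_noise)"
    unfolding moment_def
    by (intro integral_mono integrable_product_norm integrable_sum_column_norm powr_le)
  also have "\<dots> = (real d powr s * real d) * moment white_noise step_gain s ^ k"
    by (simp add: column_moments)
  finally show "moment white_noise (product_norm k) s
      \<le> (real d powr s * real d) * moment white_noise step_gain s ^ k" .
qed

lemma hfun_eq_moment:
  assumes s_pos: "s > 0"
  shows "hfun \<eta> 1 b d s = moment white_noise step_gain s"
proof -
  have "(\<lambda>k. moment white_noise (product_norm k) s powr (1 / real k))
      \<longlonglongrightarrow> moment white_noise step_gain s"
    using d_pos s_pos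
    by (intro power_sandwich_root_tendsto[where C="real d powr s * real d"] moment_pos
        moment_product_norm_bounds) auto
  then show ?thesis
    by (simp add: hfun_def data_space_1 moment_def product_norm_def limI)
qed

lemma AE_column_norm_le_exp:
  assumes j_less: "j < d" and "\<epsilon> > 0"
  shows "AE w in white_noise. \<forall>\<^sub>F k in sequentially.
      column_norm j k w \<le> exp (real k * (lyapunov_exponent + \<epsilon>))"
proof -
  obtain s where s_props: "s > 0"
      "moment white_noise step_gain s < exp (s * (lyapunov_exponent + \<epsilon>))"
    using ex_moment_less[OF \<open>\<epsilon> > 0\<close>] by blast
  have "AE w in white_noise. \<forall>\<^sub>F k in sequentially.
      column_norm j k w powr s < exp (s * (lyapunov_exponent + \<epsilon>)) ^ k"
    using moment_column_norm[OF _ j_less, of s] s_props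
    by (intro AE_eventually_less_power) (auto simp: moment_def[symmetric])
  then show ?thesis
  proof eventually_elim
    case (elim w)
    then show ?case
    proof eventually_elim
      case (elim k)
      show ?case
      proof (rule ccontr)
        assume "\<not> ?thesis"
        then have "exp (real k * (lyapunov_exponent + \<epsilon>)) powr s \<le> column_norm j k w powr s"
          using s_props(1) by (intro powr_mono2) auto
        then show False
          using elim by (simp add: powr_def mult_ac flip: exp_of_nat_mult)
      qed
    qed
  qed
qed

lemma AE_exp_le_column_norm:
  assumes j_less: "j < d" and "\<epsilon> > 0"
  shows "AE w in white_noise. \<forall>\<^sub>F k in sequentially.
      exp (real k * (lyapunov_exponent - \<epsilon>)) \<le> column_norm j k w"
proof -
  obtain s where s_props: "s > 0" "s \<le> 1/4"
      "moment white_noise step_gain (- s) < exp (- s * (lyapunov_exponent - \<epsilon>))"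
    using ex_moment_neg_less[OF \<open>\<epsilon> > 0\<close>] by blast
  have "AE w in white_noise. \<forall>\<^sub>F k in sequentially.
      column_norm j k w powr - s < exp (- s * (lyapunov_exponent - \<epsilon>)) ^ k"
    using moment_column_norm[OF _ j_less, of "- s"] s_props
    by (intro AE_eventually_less_power) (auto simp: moment_def[symmetric])
  moreover have "AE w in white_noise. \<forall>k. column_norm j k w > 0"
    unfolding AE_all_countable by (intro allI AE_column_norm_pos j_less)
  ultimately show ?thesis
  proof eventually_elim
    case (elim w)
    from elim(1) show ?case
    proof eventually_elim
      case (elim k)
      show ?case
      proof (rule ccontr)
        assume "\<not> ?thesis"
        then have "exp (real k * (lyapunov_exponent - \<epsilon>)) powr - s \<le> column_norm j k w powr - s"
          using s_props(1) \<open>\<forall>k. column_norm j k w > 0\<close> by (intro powr_mono2') auto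
        then show False
          using elim by (simp add: powr_def mult_ac flip: exp_of_nat_mult)
      qed
    qed
  qed
qed

lemma AE_ln_product_norm_tendsto: "AE w in white_noise.
    (\<lambda>k. ln (product_norm k w) / real k) \<longlonglongrightarrow> lyapunov_exponent"
proof (rule AE_tendstoI)
  fix \<epsilon> :: real assume eps_pos: "\<epsilon> > 0"
  have "(\<lambda>k. ln (real d) / real k) \<longlonglongrightarrow> 0"
    by (rule lim_const_over_n)
  then have ln_d_small: "\<forall>\<^sub>F k in sequentially. ln (real d) / real k < \<epsilon> / 2"
    using eps_pos by (intro order_tendstoD(2)) auto
  have "AE w in white_noise. \<forall>j\<in>{..<d}. \<forall>\<^sub>F k in sequentially.
      column_norm j k w \<le> exp (real k * (lyapunov_exponent + \<epsilon> / 2))"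
    using eps_pos by (intro AE_finite_allI AE_column_norm_le_exp) auto
  moreover have "AE w in white_noise. \<forall>\<^sub>F k in sequentially.
      exp (real k * (lyapunov_exponent - \<epsilon> / 2)) \<le> column_norm 0 k w"
    using eps_pos d_pos by (intro AE_exp_le_column_norm) auto
  ultimately show "AE w in white_noise. \<forall>\<^sub>F k in sequentially.
      dist (ln (product_norm k w) / real k) lyapunov_exponent < \<epsilon>"
  proof eventually_elim
    case (elim w)
    then have "\<forall>\<^sub>F k in sequentially.
        \<forall>j\<in>{..<d}. column_norm j k w \<le> exp (real k * (lyapunov_exponent + \<epsilon> / 2))"
      by (intro eventually_ball_finite) auto
    with elim(2) ln_d_small eventually_gt_at_top[of 0] show ?case
    proof eventually_elim
      case (elim k)
      have "exp (real k * (lyapunov_exponent - \<epsilon> / 2)) \<le> product_norm k w"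
        using elim(1) column_norm_le_product_norm[of 0 k w] d_pos by simp
      moreover have "product_norm k w \<le> real d * exp (real k * (lyapunov_exponent + \<epsilon> / 2))"
        using product_norm_le_sum_column_norm[of k w] elim(4)
          sum_bounded_above[of "{..<d}" "\<lambda>j. column_norm j k w"]
        by fastforce
      ultimately have "lyapunov_exponent - \<epsilon> / 2 \<le> ln (product_norm k w) / real k"
        "ln (product_norm k w) / real k \<le> ln (real d) / real k + (lyapunov_exponent + \<epsilon> / 2)"
        using ln_div_bounds[of "real k" "real d"] elim(3) d_pos by auto
      then show ?case
        using elim(2) unfolding dist_real_def by linarith
    qed
  qed
qed

lemma rho_eq_lyapunov_exponent: "rho \<eta> 1 b d = lyapunov_exponent"
proof -
  let ?ratio = "\<lambda>w k. ln (lambda_max (transpose_mat (Pimat \<eta> b d w k) * Pimat \<eta> b d w k)) / (2 * real k)"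
  have "?ratio w k = ln (product_norm k w) / real k" for w k
    by (cases "product_norm k w = 0")
       (simp_all add: lambda_max_gram_mat[OF Pimat_carrier d_pos] ln_realpow less_le flip: product_norm_def)
  then have lim: "AE w in white_noise. ?ratio w \<longlonglongrightarrow> lyapunov_exponent"
    using AE_ln_product_norm_tendsto by simp
  show ?thesis
    unfolding rho_def data_space_1
  proof (rule the_equality)
    fix r assume "AE w in white_noise. ?ratio w \<longlonglongrightarrow> r"
    with lim have "AE w in (white_noise :: (nat \<times> nat \<Rightarrow> real) measure). lyapunov_exponent = r"
      by eventually_elim (rule LIMSEQ_unique)
    then show "r = lyapunov_exponent" by (simp add: AE_const)
  qed (rule lim)
qed

lemma tail_index_root:
  assumes "admissible \<eta> 1 b d"
  shows "tail_index \<eta> 1 b d > 0" "moment white_noise step_gain (tail_index \<eta> 1 b d) = 1"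
proof -
  have "\<exists>!\<alpha>. \<alpha> > 0 \<and> moment white_noise step_gain \<alpha> = 1"
    using assms by (intro ex1_moment_eq_1) (simp add: admissible_def rho_eq_lyapunov_exponent)
  moreover have "tail_index \<eta> 1 b d = (THE \<alpha>. \<alpha> > 0 \<and> moment white_noise step_gain \<alpha> = 1)"
    unfolding tail_index_def by (rule arg_cong[where f=The]) (auto simp: hfun_eq_moment fun_eq_iff)
  ultimately show "tail_index \<eta> 1 b d > 0" "moment white_noise step_gain (tail_index \<eta> 1 b d) = 1"
    using theI'[of "\<lambda>\<alpha>. \<alpha> > 0 \<and> moment white_noise step_gain \<alpha> = 1"] by simp_all
qed

end

lemma
  assumes "admissible \<eta> v b d"
  defines "g \<equiv> moment white_noise (gain (\<eta> * v / real b) {1..b} d)"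
  shows tail_index_pos: "tail_index \<eta> v b d > 0"
    and moment_tail_index: "g (tail_index \<eta> v b d) = 1"
    and less_tail_index: "g s < 1 \<Longrightarrow> s < tail_index \<eta> v b d"
    and tail_index_less: "\<lbrakk>s > 0; g s > 1\<rbrakk> \<Longrightarrow> tail_index \<eta> v b d < s"
proof -
  have admissible_1: "admissible (\<eta> * v) 1 b d"
    by (rule admissible_unit_variance[OF assms(1)])
  then interpret unit_variance_sgd "\<eta> * v" b d
    by unfold_locales (auto simp: admissible_def)
  note root = tail_index_root[OF admissible_1, folded tail_index_unit_variance[OF assms(1)]]
  show "tail_index \<eta> v b d > 0" "g (tail_index \<eta> v b d) = 1"
    "g s < 1 \<Longrightarrow> s < tail_index \<eta> v b d" "\<lbrakk>s > 0; g s > 1\<rbrakk> \<Longrightarrow> tail_index \<eta> v b d < s"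
    unfolding g_def using root less_moment_root[OF root] moment_root_less[OF root(2)] by auto
qed

section \<open>Monotonicity of the tail-index\<close>

lemma integrable_gain_powr:
  assumes "finite I" "s > 0"
  shows "integrable white_noise (\<lambda>w. gain \<kappa> I d w powr s)"
  using has_all_moments_gain[OF assms(1), of \<kappa> d] assms(2) by (simp add: has_all_moments_def)

lemma continuous_on_gain_powr: "s > 0 \<Longrightarrow> continuous_on UNIV (\<lambda>w. gain \<kappa> I d w powr s)"
  by (intro continuous_on_powr' continuous_on_gain continuous_on_const) auto

lemma moment_gain_dim_less:
  assumes dims: "1 \<le> d1" "d1 < d2" and batch: "finite I" "I \<noteq> {}" and kappa_pos: "\<kappa> > 0"
    and s_pos: "s > 0"
  shows "moment white_noise (gain \<kappa> I d1) s < moment white_noise (gain \<kappa> I d2) s"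
proof -
  have gain_power2_eq: "(gain \<kappa> I d2 w)\<^sup>2
      = (gain \<kappa> I d1 w)\<^sup>2 + (\<Sum>p\<in>{d1..<d2}. (first_column \<kappa> I w p)\<^sup>2)" for w
    using dims by (simp add: gain_def L2_set_power2 lessThan_atLeast0 sum.atLeastLessThan_concat)
  define w :: "nat \<times> nat \<Rightarrow> real" where "w = (\<lambda>_. 1)"
  have "first_column \<kappa> I w d1 \<noteq> 0"
    using dims batch kappa_pos by (simp add: first_column_def w_def)
  then have "0 < (first_column \<kappa> I w d1)\<^sup>2" by simp
  also have "\<dots> \<le> (\<Sum>p\<in>{d1..<d2}. (first_column \<kappa> I w p)\<^sup>2)"
    using dims by (intro member_le_sum) auto
  finally have "gain \<kappa> I d1 w < gain \<kappa> I d2 w"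
    using gain_power2_eq[of w] by (intro power2_less_imp_less[of "gain \<kappa> I d1 w"]) auto
  then have "gain \<kappa> I d1 w powr s < gain \<kappa> I d2 w powr s"
    using s_pos by (intro powr_less_mono2) auto
  moreover have "gain \<kappa> I d1 w powr s \<le> gain \<kappa> I d2 w powr s" for w
    using s_pos gain_power2_eq[of w]
    by (intro powr_mono2 power2_le_imp_le[of "gain \<kappa> I d1 w"]) (auto simp: sum_nonneg)
  ultimately show ?thesis
    unfolding moment_def using s_pos batch
    by (intro integral_white_noise_less[where w=w] integrable_gain_powr continuous_on_gain_powr) auto
qed

lemma moment_gain_stepsize_less:
  assumes d_pos: "d \<ge> 1" and batch: "finite I" "I \<noteq> {}" and stepsizes: "0 < \<kappa>1" "\<kappa>1 < \<kappa>2"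
    and s_ge_1: "s \<ge> 1"
  defines "t \<equiv> \<kappa>1 / \<kappa>2"
  shows "moment white_noise (gain \<kappa>1 I d) s < t * moment white_noise (gain \<kappa>2 I d) s + (1 - t)"
proof -
  interpret prob_space "white_noise :: (nat \<times> nat \<Rightarrow> real) measure" by (rule prob_space_white_noise)
  have t_props: "0 < t" "t < 1" "\<kappa>1 = t * \<kappa>2" using stepsizes by (auto simp: t_def)
  define a where "a b = (if b then t else 1 - t)" for b
  define f where "f w b = (if b then first_column \<kappa>2 I w else indicator {0})" for w b
  have "first_column \<kappa>1 I w = (\<lambda>p. \<Sum>b\<in>{True, False}. a b * f w b p)" for w
    by (rule ext) (simp add: a_def f_def first_column_def t_props(3) algebra_simps)
  then have gain_eq: "gain \<kappa>1 I d w = L2_set (\<lambda>p. \<Sum>b\<in>{True, False}. a b * f w b p) {..<d}" for w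
    by (simp only: gain_def)
  have sum_eq: "(\<Sum>b\<in>{True, False}. a b * L2_set (f w b) {..<d} powr s)
      = t * gain \<kappa>2 I d w powr s + (1 - t)" for w
    using d_pos by (simp add: a_def f_def gain_def L2_set_indicator_singleton)
  have weights: "\<And>b. b \<in> {True, False} \<Longrightarrow> a b \<ge> 0" "(\<Sum>b\<in>{True, False}. a b) = 1" "a True > 0"
      "a False > 0"
    using t_props by (auto simp: a_def)
  define w :: "nat \<times> nat \<Rightarrow> real" where "w = (\<lambda>_. sqrt (2 / \<kappa>2))"
  have "real (card I) \<ge> 1"
    using batch by (simp add: Suc_le_eq card_gt_0_iff)
  then have "f w False 0 > 0" "f w True 0 < 0"
    using stepsizes by (simp_all add: f_def w_def first_column_def)
  then have strict_at_w: "gain \<kappa>1 I d w powr s < t * gain \<kappa>2 I d w powr s + (1 - t)"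
    unfolding gain_eq sum_eq[symmetric] using weights s_ge_1 d_pos
    by (intro L2_set_convex_sum_powr_less[where r=0 and j=False and k=True]) auto
  have pointwise_le: "gain \<kappa>1 I d w powr s \<le> t * gain \<kappa>2 I d w powr s + (1 - t)" for w
    unfolding gain_eq sum_eq[symmetric] using weights s_ge_1
    by (intro L2_set_convex_sum_powr_le) auto
  have integrable_gain: "integrable white_noise (\<lambda>w. gain \<kappa> I d w powr s)" for \<kappa>
    using batch s_ge_1 by (intro integrable_gain_powr) auto
  have "moment white_noise (gain \<kappa>1 I d) s < expectation (\<lambda>w. t * gain \<kappa>2 I d w powr s + (1 - t))"
    unfolding moment_def
    by (rule integral_white_noise_less[where w=w])
       (use s_ge_1 integrable_gain pointwise_le strict_at_w in
         \<open>auto intro!: continuous_intros continuous_on_gain_powr\<close>)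
  also have "\<dots> = t * moment white_noise (gain \<kappa>2 I d) s + (1 - t)"
    using integrable_gain prob_space by (simp add: moment_def)
  finally show ?thesis .
qed

lemma moment_gain_card_cong:
  assumes "finite I" "finite I'" "card I = card I'"
  shows "moment white_noise (gain \<kappa> I d) s = moment white_noise (gain \<kappa> I' d) s"
  unfolding moment_def using nn_integral_gain_card_cong[OF _ assms, of "\<lambda>x. ennreal (x powr s)"]
  by (simp add: integral_eq_nn_integral)

lemma first_column_eq_leave_one_out_mean:
  assumes card_J: "finite J" "card J = Suc b" and "b \<ge> 1"
  shows "first_column (\<eta> / real (Suc b)) J w p
    = (\<Sum>j\<in>J. 1 / real (Suc b) * first_column (\<eta> / real b) (J - {j}) w p)"
proof -
  define y where "y i = w (i, p) * w (i, 0)" for i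
  have "(\<Sum>j\<in>J. \<Sum>i\<in>J - {j}. y i) = (\<Sum>j\<in>J. (\<Sum>i\<in>J. y i) - y j)"
    using card_J by (intro sum.cong) (auto simp: sum_diff1)
  also have "\<dots> = real b * (\<Sum>i\<in>J. y i)"
    using card_J by (simp add: sum_subtractf algebra_simps)
  finally have leave_one_out: "(\<Sum>j\<in>J. \<Sum>i\<in>J - {j}. y i) = real b * (\<Sum>i\<in>J. y i)" .
  have "(\<Sum>j\<in>J. first_column (\<eta> / real b) (J - {j}) w p)
      = real (Suc b) * indicator {0} p - \<eta> / real b * (\<Sum>j\<in>J. \<Sum>i\<in>J - {j}. y i)"
    by (simp only: first_column_def y_def sum_subtractf sum_distrib_left[symmetric] sum_constant card_J(2))
  also have "\<dots> = real (Suc b) * indicator {0} p - \<eta> * (\<Sum>i\<in>J. y i)"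
    using \<open>b \<ge> 1\<close> by (simp add: leave_one_out)
  also have "\<dots> = real (Suc b) * first_column (\<eta> / real (Suc b)) J w p"
    by (simp add: first_column_def y_def right_diff_distrib)
  finally show ?thesis
    by (simp flip: sum_distrib_left sum_divide_distrib)
qed

text \<open>The average over a batch of size \<open>b + 1\<close> is the mean of the \<open>b + 1\<close> leave-one-out averages,
  each of which has the law of an average over a batch of size \<open>b\<close>.\<close>

lemma moment_gain_batch_Suc_less:
  assumes d_pos: "d \<ge> 1" and b_pos: "b \<ge> 1" and eta_pos: "\<eta> > 0" and s_ge_1: "s \<ge> 1"
  shows "moment white_noise (gain (\<eta> / real (Suc b)) {1..Suc b} d) s
      < moment white_noise (gain (\<eta> / real b) {1..b} d) s"
proof -
  define J \<kappa> c where "J = {1..Suc b}" and "\<kappa> = \<eta> / real b" and "c = 1 / real (Suc b)"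
  have J_props: "finite J" "card J = Suc b" "J \<noteq> {}" "1 \<in> J" "Suc b \<in> J"
    and weights: "c > 0" "(\<Sum>j\<in>J. c) = 1" and kappa_pos: "\<kappa> > 0"
    using b_pos eta_pos by (auto simp: J_def c_def \<kappa>_def)
  have gain_eq: "gain (\<eta> / real (Suc b)) J d w
      = L2_set (\<lambda>p. \<Sum>j\<in>J. c * first_column \<kappa> (J - {j}) w p) {..<d}" for w
    by (simp only: gain_def first_column_eq_leave_one_out_mean[OF J_props(1,2) b_pos, abs_def] c_def \<kappa>_def)
  define w :: "nat \<times> nat \<Rightarrow> real" where "w = (\<lambda>_. 0)((1, 0) := sqrt (2 / \<kappa>))"
  have w_square: "w (i, 0) * w (i, 0) = (if i = 1 then 2 / \<kappa> else 0)" for i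
    using kappa_pos by (simp add: w_def)
  have "first_column \<kappa> (J - {1}) w 0 > 0" "first_column \<kappa> (J - {Suc b}) w 0 < 0"
    using J_props b_pos kappa_pos by (auto simp: first_column_def w_square)
  then have strict_at_w: "gain (\<eta> / real (Suc b)) J d w powr s
      < (\<Sum>j\<in>J. c * gain \<kappa> (J - {j}) d w powr s)"
    unfolding gain_eq unfolding gain_def using J_props weights s_ge_1 d_pos
    by (intro L2_set_convex_sum_powr_less[where r=0 and j=1 and k="Suc b"]) auto
  have pointwise_le: "gain (\<eta> / real (Suc b)) J d w powr s
      \<le> (\<Sum>j\<in>J. c * gain \<kappa> (J - {j}) d w powr s)" for w
    unfolding gain_eq unfolding gain_def using J_props weights s_ge_1
    by (intro L2_set_convex_sum_powr_le) auto
  have integrable_gain: "integrable white_noise (\<lambda>w. gain \<kappa> I d w powr s)" if "finite I" for \<kappa> I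
    using s_ge_1 that by (intro integrable_gain_powr) auto
  have "moment white_noise (gain (\<eta> / real (Suc b)) J d) s
      < (\<integral>w. (\<Sum>j\<in>J. c * gain \<kappa> (J - {j}) d w powr s) \<partial>white_noise)"
    unfolding moment_def
    by (rule integral_white_noise_less[where w=w])
       (use s_ge_1 integrable_gain J_props pointwise_le strict_at_w in
         \<open>auto intro!: continuous_intros continuous_on_gain_powr\<close>)
  also have "\<dots> = (\<Sum>j\<in>J. c * moment white_noise (gain \<kappa> (J - {j}) d) s)"
    using integrable_gain J_props by (simp add: moment_def)
  also have "\<dots> = (\<Sum>j\<in>J. c * moment white_noise (gain \<kappa> {1..b} d) s)"
    using J_props by (intro sum.cong refl arg_cong2[where f="(*)"] moment_gain_card_cong) auto
  also have "\<dots> = moment white_noise (gain \<kappa> {1..b} d) s"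
    using weights(2) by (simp flip: sum_distrib_right)
  finally show ?thesis by (simp add: J_def \<kappa>_def)
qed

lemma moment_gain_batch_less:
  assumes "d \<ge> 1" "1 \<le> b1" "b1 < b2" "\<eta> > 0" "s \<ge> 1"
  shows "moment white_noise (gain (\<eta> / real b2) {1..b2} d) s
      < moment white_noise (gain (\<eta> / real b1) {1..b1} d) s"
proof -
  have "Suc b1 \<le> b2" using \<open>b1 < b2\<close> by simp
  then show ?thesis
  proof (induction rule: dec_induct)
    case base
    show ?case using assms by (intro moment_gain_batch_Suc_less) auto
  next
    case (step n)
    have "moment white_noise (gain (\<eta> / real (Suc n)) {1..Suc n} d) s
        < moment white_noise (gain (\<eta> / real n) {1..n} d) s"
      using assms step.hyps by (intro moment_gain_batch_Suc_less) auto
    then show ?case using step.IH by simp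
  qed
qed

lemma tail_index_batch_less:
  assumes "admissible \<eta> v b1 d" "admissible \<eta> v b2 d" "b1 < b2" "tail_index \<eta> v b1 d \<ge> 1"
  shows "tail_index \<eta> v b1 d < tail_index \<eta> v b2 d"
proof (rule less_tail_index[OF assms(2)])
  have "moment white_noise (gain (\<eta> * v / real b2) {1..b2} d) (tail_index \<eta> v b1 d)
      < moment white_noise (gain (\<eta> * v / real b1) {1..b1} d) (tail_index \<eta> v b1 d)"
    using assms by (intro moment_gain_batch_less) (auto simp: admissible_def)
  also have "\<dots> = 1"
    by (rule moment_tail_index[OF assms(1)])
  finally show "moment white_noise (gain (\<eta> * v / real b2) {1..b2} d) (tail_index \<eta> v b1 d) < 1" .
qed

lemma tail_index_stepsize_variance_less:
  assumes "admissible \<eta>1 v1 b d" "admissible \<eta>2 v2 b d" "\<eta>1 * v1 < \<eta>2 * v2"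
      "tail_index \<eta>1 v1 b d \<ge> 1"
  shows "tail_index \<eta>2 v2 b d < tail_index \<eta>1 v1 b d"
proof (rule tail_index_less[OF assms(2) tail_index_pos[OF assms(1)]])
  define \<kappa>1 \<kappa>2 where "\<kappa>1 = \<eta>1 * v1 / real b" and "\<kappa>2 = \<eta>2 * v2 / real b"
  let ?g = "\<lambda>\<kappa>. moment white_noise (gain \<kappa> {1..b} d) (tail_index \<eta>1 v1 b d)"
  have sizes_pos: "b \<ge> 1" "d \<ge> 1" and stepsizes: "0 < \<kappa>1" "\<kappa>1 < \<kappa>2"
    using assms by (auto simp: admissible_def \<kappa>1_def \<kappa>2_def divide_strict_right_mono)
  have "1 = ?g \<kappa>1"
    using moment_tail_index[OF assms(1)] by (simp add: \<kappa>1_def)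
  also have "\<dots> < \<kappa>1 / \<kappa>2 * ?g \<kappa>2 + (1 - \<kappa>1 / \<kappa>2)"
    using sizes_pos stepsizes assms(4) by (intro moment_gain_stepsize_less) auto
  finally have "\<kappa>1 / \<kappa>2 * 1 < \<kappa>1 / \<kappa>2 * ?g \<kappa>2"
    by simp
  moreover have "0 < \<kappa>1 / \<kappa>2"
    using stepsizes by simp
  ultimately show "1 < moment white_noise (gain (\<eta>2 * v2 / real b) {1..b} d) (tail_index \<eta>1 v1 b d)"
    unfolding \<kappa>2_def by (simp only: mult_less_cancel_left_pos)
qed

lemma tail_index_dim_less:
  assumes "admissible \<eta> v b d1" "admissible \<eta> v b d2" "d1 < d2"
  shows "tail_index \<eta> v b d2 < tail_index \<eta> v b d1"
proof (rule tail_index_less[OF assms(2) tail_index_pos[OF assms(1)]])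
  have "1 = moment white_noise (gain (\<eta> * v / real b) {1..b} d1) (tail_index \<eta> v b d1)"
    by (rule moment_tail_index[OF assms(1), symmetric])
  also have "\<dots> < moment white_noise (gain (\<eta> * v / real b) {1..b} d2) (tail_index \<eta> v b d1)"
    using assms tail_index_pos[OF assms(1)]
    by (intro moment_gain_dim_less) (auto simp: admissible_def)
  finally show "1 < moment white_noise (gain (\<eta> * v / real b) {1..b} d2) (tail_index \<eta> v b d1)" .
qed

theorem theorem4:
  shows
   "(\<forall>\<eta> v d b1 b2. admissible \<eta> v b1 d \<and> admissible \<eta> v b2 d \<and> b1 < b2 \<and>
        tail_index \<eta> v b1 d \<ge> 1 \<and> tail_index \<eta> v b2 d \<ge> 1
        \<longrightarrow> tail_index \<eta> v b1 d < tail_index \<eta> v b2 d)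
  \<and> (\<forall>\<eta>1 \<eta>2 v b d. admissible \<eta>1 v b d \<and> admissible \<eta>2 v b d \<and> \<eta>1 < \<eta>2 \<and>
        tail_index \<eta>1 v b d \<ge> 1 \<and> tail_index \<eta>2 v b d \<ge> 1
        \<longrightarrow> tail_index \<eta>2 v b d < tail_index \<eta>1 v b d)
  \<and> (\<forall>\<eta> v1 v2 b d. admissible \<eta> v1 b d \<and> admissible \<eta> v2 b d \<and> v1 < v2 \<and>
        tail_index \<eta> v1 b d \<ge> 1 \<and> tail_index \<eta> v2 b d \<ge> 1
        \<longrightarrow> tail_index \<eta> v2 b d < tail_index \<eta> v1 b d)
  \<and> (\<forall>\<eta> v b d1 d2. admissible \<eta> v b d1 \<and> admissible \<eta> v b d2 \<and> d1 < d2
        \<longrightarrow> tail_index \<eta> v b d2 < tail_index \<eta> v b d1)"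
proof (intro conjI allI impI; elim conjE)
  show "tail_index \<eta> v b1 d < tail_index \<eta> v b2 d"
    if "admissible \<eta> v b1 d" "admissible \<eta> v b2 d" "b1 < b2" "1 \<le> tail_index \<eta> v b1 d"
      for \<eta> v d b1 b2
    using that by (rule tail_index_batch_less)
  show "tail_index \<eta>2 v b d < tail_index \<eta>1 v b d"
    if "admissible \<eta>1 v b d" "admissible \<eta>2 v b d" "\<eta>1 < \<eta>2" "1 \<le> tail_index \<eta>1 v b d"
      for \<eta>1 \<eta>2 v b d
    using that by (intro tail_index_stepsize_variance_less) (auto simp: admissible_def)
  show "tail_index \<eta> v2 b d < tail_index \<eta> v1 b d"
    if "admissible \<eta> v1 b d" "admissible \<eta> v2 b d" "v1 < v2" "1 \<le> tail_index \<eta> v1 b d"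
      for \<eta> v1 v2 b d
    using that by (intro tail_index_stepsize_variance_less) (auto simp: admissible_def)
  show "tail_index \<eta> v b d2 < tail_index \<eta> v b d1"
    if "admissible \<eta> v b d1" "admissible \<eta> v b d2" "d1 < d2" for \<eta> v b d1 d2
    using that by (rule tail_index_dim_less)
qed

end
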